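(* Every di-$\mathrm{Var}$-dendriform algebra $A$ over $\Bbbk$ embeds into its universal enveloping Rota--Baxter $\mathrm{Var}$-algebra of weight $\lambda=0$; that is, the canonical map from $A$ to this universal enveloping algebra is injective.
   Context: $\Bbbk$ is an arbitrary field. $\Omega=\{\circ_i\mid i\in I\}$ is a set of binary operation symbols; an $\Omega$-algebra is a $\Bbbk$-linear space with bilinear operations $\circ_i$, $i\in I$. An $\Omega^{(2)}$-algebra is a $\Bbbk$-linear space with bilinear operations $\vdash_i,\dashv_i$, $i\in I$. $\mathrm{Var}$ is the variety of $\Omega$-algebras defined by a family $S$ of poly-linear identities of degrees greater than one: each $f\in S$ of degree $n$ is a $\Bbbk$-linear combination of non-associative $\Omega$-monomials in which each of $x_1,\dots,x_n$ occurs exactly once (in any order and with any bracketing). For a poly-linear $\Omega$-monomial $v$, let $v^*$ be the $\Omega^{(2)}$-polynomial obtained by replacing each $\circ_j$ in $v$ with $\vdash_j+\dashv_j$ (and expanding). For a poly-linear $\Omega$-monomial $u$ and an index $k$ such that $x_k$ occurs in $u$, define $\Phi^*(u^{\{k\}})$ recursively: if $u=x_k$, then $\Phi^*(u^{\{k\}})=x_k$; if $u=v\circ_i w$, then $\Phi^*(u^{\{k\}})=v^*\vdash_i\Phi^*(w^{\{k\}})$ when $x_k$ occurs in $w$, and $\Phi^*(u^{\{k\}})=\Phi^*(v^{\{k\}})\dashv_i w^*$ when $x_k$ occurs in $v$. Extend linearly to poly-linear $f$. A di-$\mathrm{Var}$-dendriform algebra is an $\Omega^{(2)}$-algebra satisfying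 the identities $\Phi^*(f^{\{k\}})=0$ for all $f\in S$ and $k=1,\dots,\deg f$. A Rota--Baxter $\mathrm{Var}$-algebra of weight $0$ is an algebra $B\in\mathrm{Var}$ with a linear map $R:B\to B$ such that $R(x)\circ_i R(y)=R(x\circ_i R(y)+R(x)\circ_i y)$ for all $x,y\in B$, $i\in I$. Each such $(B,R)$ is regarded as an $\Omega^{(2)}$-algebra $B^{\mathrm{dend}}$ (which is di-$\mathrm{Var}$-dendriform) via $x\vdash_i y=R(x)\circ_i y$, $x\dashv_i y=x\circ_i R(y)$. The universal enveloping Rota--Baxter $\mathrm{Var}$-algebra of weight $0$ of $A$ is a Rota--Baxter $\mathrm{Var}$-algebra $U$ of weight $0$ with a homomorphism of $\Omega^{(2)}$-algebras $A\to U^{\mathrm{dend}}$ (the canonical map) such that every homomorphism of $\Omega^{(2)}$-algebras $A\to B^{\mathrm{dend}}$, for $B$ a Rota--Baxter $\mathrm{Var}$-algebra of weight $0$, factors uniquely through it via a homomorphism $U\to B$ of Rota--Baxter algebras (an $\Omega$-algebra homomorphism commuting with the Rota--Baxter operators). *)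

theory Defs
  imports "HOL-Algebra.Module"
begin

text \<open>
  Linear spaces over a field \<open>K\<close> are modules over \<open>K\<close> in the sense of \<^theory>\<open>HOL-Algebra.Module\<close>.
  The fields \<open>mult\<close> and \<open>one\<close> of that record play no role here: the locale \<open>module\<close> does not
  constrain them, and the bilinear operations are given by the additional field \<open>opr\<close>.
\<close>

record ('k, 'a, 'i) alg = "('k, 'a) module" +
  opr :: "'i \<Rightarrow> 'a \<Rightarrow> 'a \<Rightarrow> 'a"

record ('k, 'a, 'i) rb_alg = "('k, 'a, 'i) alg" +
  rb :: "'a \<Rightarrow> 'a"

definition linear_maps ::
  "('k, 'r) ring_scheme \<Rightarrow> ('k, 'a, 'm) module_scheme \<Rightarrow> ('k, 'b, 'n) module_scheme \<Rightarrow> ('a \<Rightarrow> 'b) set"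
where
  "linear_maps K M N = {h. h \<in> carrier M \<rightarrow> carrier N \<and>
     (\<forall>x\<in>carrier M. \<forall>y\<in>carrier M. h (x \<oplus>\<^bsub>M\<^esub> y) = h x \<oplus>\<^bsub>N\<^esub> h y) \<and>
     (\<forall>c\<in>carrier K. \<forall>x\<in>carrier M. h (c \<odot>\<^bsub>M\<^esub> x) = c \<odot>\<^bsub>N\<^esub> h x)}"

definition omega_algebra ::
  "('k, 'r) ring_scheme \<Rightarrow> 'i set \<Rightarrow> ('k, 'a, 'i, 'm) alg_scheme \<Rightarrow> bool"
where
  "omega_algebra K I A \<longleftrightarrow> module K A \<and>
     (\<forall>i\<in>I. \<forall>x\<in>carrier A. opr A i x \<in> linear_maps K A A \<and> (\<lambda>y. opr A i y x) \<in> linear_maps K A A)"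

definition alg_hom ::
  "('k, 'r) ring_scheme \<Rightarrow> 'i set \<Rightarrow> ('k, 'a, 'i, 'm) alg_scheme \<Rightarrow> ('k, 'b, 'i, 'n) alg_scheme
   \<Rightarrow> ('a \<Rightarrow> 'b) set"
where
  "alg_hom K I A B = {h \<in> linear_maps K A B.
     \<forall>i\<in>I. \<forall>x\<in>carrier A. \<forall>y\<in>carrier A. h (opr A i x y) = opr B i (h x) (h y)}"


section \<open>Non-associative polynomials and identities\<close>

datatype (op_symbols: 'i) monomial = Var nat | Op 'i "'i monomial" "'i monomial"

text \<open>
  A polynomial is represented by its coefficient function; the ones of interest have finite support.
\<close>

type_synonym ('k, 'i) npoly = "'i monomial \<Rightarrow> 'k"

primrec vars :: "'i monomial \<Rightarrow> nat list" where
  "vars (Var k) = [k]"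
| "vars (Op i v w) = vars v @ vars w"

definition support :: "('k, 'r) ring_scheme \<Rightarrow> ('k, 'i) npoly \<Rightarrow> 'i monomial set" where
  "support K f = {u. f u \<noteq> \<zero>\<^bsub>K\<^esub>}"

text \<open>
  Poly-linear polynomials of degree \<open>n\<close>. The number \<open>n\<close> is determined by \<open>f\<close> unless \<open>f\<close> is zero, and
  the zero polynomial gives a void identity.
\<close>

definition polylinear ::
  "('k, 'r) ring_scheme \<Rightarrow> 'i set \<Rightarrow> nat \<Rightarrow> ('k, 'i) npoly \<Rightarrow> bool"
where
  "polylinear K I n f \<longleftrightarrow> range f \<subseteq> carrier K \<and> finite (support K f) \<and>
     (\<forall>u\<in>support K f. op_symbols u \<subseteq> I \<and> distinct (vars u) \<and> set (vars u) = {1..n})"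

primrec eval_mono :: "('k, 'a, 'i, 'm) alg_scheme \<Rightarrow> (nat \<Rightarrow> 'a) \<Rightarrow> 'i monomial \<Rightarrow> 'a" where
  "eval_mono A \<rho> (Var k) = \<rho> k"
| "eval_mono A \<rho> (Op i v w) = opr A i (eval_mono A \<rho> v) (eval_mono A \<rho> w)"

definition eval_poly ::
  "('k, 'r) ring_scheme \<Rightarrow> ('k, 'a, 'i, 'm) alg_scheme \<Rightarrow> (nat \<Rightarrow> 'a) \<Rightarrow> ('k, 'i) npoly \<Rightarrow> 'a"
where
  "eval_poly K A \<rho> f = (\<Oplus>\<^bsub>A\<^esub>u\<in>support K f. f u \<odot>\<^bsub>A\<^esub> eval_mono A \<rho> u)"

definition satisfies ::
  "('k, 'r) ring_scheme \<Rightarrow> ('k, 'a, 'i, 'm) alg_scheme \<Rightarrow> ('k, 'i) npoly \<Rightarrow> bool"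
where
  "satisfies K A f \<longleftrightarrow> (\<forall>\<rho>. range \<rho> \<subseteq> carrier A \<longrightarrow> eval_poly K A \<rho> f = \<zero>\<^bsub>A\<^esub>)"

definition in_Var ::
  "('k, 'r) ring_scheme \<Rightarrow> 'i set \<Rightarrow> ('k, 'i) npoly set \<Rightarrow> ('k, 'a, 'i, 'm) alg_scheme \<Rightarrow> bool"
where
  "in_Var K I S A \<longleftrightarrow> omega_algebra K I A \<and> (\<forall>f\<in>S. satisfies K A f)"


section \<open>Dendriform algebras\<close>

datatype 'i dend_op = Vdash 'i | Dashv 'i

definition dend_ops :: "'i set \<Rightarrow> 'i dend_op set" where
  "dend_ops I = Vdash ` I \<union> Dashv ` I"

definition pvar :: "('k, 'r) ring_scheme \<Rightarrow> nat \<Rightarrow> ('k, 'i) npoly" where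
  "pvar K k = (\<lambda>u. if u = Var k then \<one>\<^bsub>K\<^esub> else \<zero>\<^bsub>K\<^esub>)"

definition padd ::
  "('k, 'r) ring_scheme \<Rightarrow> ('k, 'i) npoly \<Rightarrow> ('k, 'i) npoly \<Rightarrow> ('k, 'i) npoly"
where
  "padd K p q = (\<lambda>u. p u \<oplus>\<^bsub>K\<^esub> q u)"

text \<open>
  The bilinear extension of \<^const>\<open>Op\<close>. No summation is needed, since a monomial that is not a
  variable arises from \<^const>\<open>Op\<close> in exactly one way.
\<close>

definition pop ::
  "('k, 'r) ring_scheme \<Rightarrow> 'i \<Rightarrow> ('k, 'i) npoly \<Rightarrow> ('k, 'i) npoly \<Rightarrow> ('k, 'i) npoly"
where
  "pop K i p q = (\<lambda>u. case u of
       Var k \<Rightarrow> \<zero>\<^bsub>K\<^esub>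
     | Op j v w \<Rightarrow> if j = i then p v \<otimes>\<^bsub>K\<^esub> q w else \<zero>\<^bsub>K\<^esub>)"

primrec star :: "('k, 'r) ring_scheme \<Rightarrow> 'i monomial \<Rightarrow> ('k, 'i dend_op) npoly" where
  "star K (Var k) = pvar K k"
| "star K (Op i v w) =
     padd K (pop K (Vdash i) (star K v) (star K w)) (pop K (Dashv i) (star K v) (star K w))"

text \<open>
  The values of \<open>Phi_mono K k u\<close> are meaningful only if \<open>k\<close> occurs exactly once in \<open>u\<close>.
\<close>

primrec Phi_mono :: "('k, 'r) ring_scheme \<Rightarrow> nat \<Rightarrow> 'i monomial \<Rightarrow> ('k, 'i dend_op) npoly" where
  "Phi_mono K k (Var j) = pvar K j"
| "Phi_mono K k (Op i v w) =
     (if k \<in> set (vars w) then pop K (Vdash i) (star K v) (Phi_mono K k w)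
      else pop K (Dashv i) (Phi_mono K k v) (star K w))"

definition Phi :: "('k, 'r) ring_scheme \<Rightarrow> nat \<Rightarrow> ('k, 'i) npoly \<Rightarrow> ('k, 'i dend_op) npoly" where
  "Phi K k f = (\<lambda>m. \<Oplus>\<^bsub>K\<^esub>u\<in>support K f. f u \<otimes>\<^bsub>K\<^esub> Phi_mono K k u m)"

definition di_Var_dendriform ::
  "('k, 'r) ring_scheme \<Rightarrow> 'i set \<Rightarrow> ('k, 'i) npoly set \<Rightarrow> ('k, 'a, 'i dend_op, 'm) alg_scheme \<Rightarrow> bool"
where
  "di_Var_dendriform K I S A \<longleftrightarrow> omega_algebra K (dend_ops I) A \<and>
     (\<forall>f\<in>S. \<forall>n. polylinear K I n f \<longrightarrow> (\<forall>k\<in>{1..n}. satisfies K A (Phi K k f)))"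


section \<open>Rota-Baxter algebras of weight zero\<close>

definition rota_baxter_Var ::
  "('k, 'r) ring_scheme \<Rightarrow> 'i set \<Rightarrow> ('k, 'i) npoly set \<Rightarrow> ('k, 'b, 'i, 'm) rb_alg_scheme \<Rightarrow> bool"
where
  "rota_baxter_Var K I S B \<longleftrightarrow> in_Var K I S B \<and> rb B \<in> linear_maps K B B \<and>
     (\<forall>i\<in>I. \<forall>x\<in>carrier B. \<forall>y\<in>carrier B.
        opr B i (rb B x) (rb B y) = rb B (opr B i x (rb B y) \<oplus>\<^bsub>B\<^esub> opr B i (rb B x) y))"

definition rb_hom ::
  "('k, 'r) ring_scheme \<Rightarrow> 'i set \<Rightarrow> ('k, 'a, 'i, 'm) rb_alg_scheme \<Rightarrow> ('k, 'b, 'i, 'n) rb_alg_scheme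
   \<Rightarrow> ('a \<Rightarrow> 'b) set"
where
  "rb_hom K I U B = {g \<in> alg_hom K I U B. \<forall>x\<in>carrier U. g (rb U x) = rb B (g x)}"

definition dend :: "('k, 'b, 'i) rb_alg \<Rightarrow> ('k, 'b, 'i dend_op) alg" where
  "dend B = \<lparr>carrier = carrier B, monoid.mult = monoid.mult B, one = one B, zero = zero B,
     add = add B, smult = smult B,
     opr = (\<lambda>j x y. case j of
         Vdash i \<Rightarrow> opr B i (rb B x) y
       | Dashv i \<Rightarrow> opr B i x (rb B y))\<rparr>"

text \<open>
  \<open>universal_envelope TYPE('b) K I S A U \<iota>\<close>: the pair \<open>(U, \<iota>)\<close> has the universal property with respect
  to all Rota-Baxter algebras \<open>B\<close> whose carrier is a subset of the type \<open>'b\<close>. As HOL has no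
  quantification over types, the type \<open>'b\<close> is a parameter. Uniqueness of the factorization is that of
  the restriction to the carrier of \<open>U\<close>, hence the use of \<^const>\<open>extensional\<close>.
\<close>

definition universal_envelope ::
  "'b itself \<Rightarrow> ('k, 'r) ring_scheme \<Rightarrow> 'i set \<Rightarrow> ('k, 'i) npoly set \<Rightarrow> ('k, 'a, 'i dend_op) alg
   \<Rightarrow> ('k, 'u, 'i) rb_alg \<Rightarrow> ('a \<Rightarrow> 'u) \<Rightarrow> bool"
where
  "universal_envelope (T :: 'b itself) K I S A U \<iota> \<longleftrightarrow>
     rota_baxter_Var K I S U \<and> \<iota> \<in> alg_hom K (dend_ops I) A (dend U) \<and>
     (\<forall>(B :: ('k, 'b, 'i) rb_alg) h.
        rota_baxter_Var K I S B \<and> h \<in> alg_hom K (dend_ops I) A (dend B) \<longrightarrow>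
        (\<exists>!g. g \<in> rb_hom K I U B \<inter> extensional (carrier U) \<and> (\<forall>x\<in>carrier A. g (\<iota> x) = h x)))"


section \<open>Existence of the universal enveloping algebra\<close>

text \<open>
  An explicit model: terms over the generators \<open>carrier A\<close> in the signature of Rota-Baxter algebras,
  modulo the congruence generated by the defining identities and the relations of \<open>A\<close>.
\<close>

datatype ('k, 'i, 'a) rb_term =
    Gen 'a
  | Zero
  | Plus "('k, 'i, 'a) rb_term" "('k, 'i, 'a) rb_term"
  | Scale 'k "('k, 'i, 'a) rb_term"
  | Prod 'i "('k, 'i, 'a) rb_term" "('k, 'i, 'a) rb_term"
  | RB "('k, 'i, 'a) rb_term"

inductive_set rb_terms ::
  "('k, 'r) ring_scheme \<Rightarrow> 'i set \<Rightarrow> ('k, 'a, 'i dend_op) alg \<Rightarrow> ('k, 'i, 'a) rb_term set"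
  for K I A
where
  "a \<in> carrier A \<Longrightarrow> Gen a \<in> rb_terms K I A"
| "Zero \<in> rb_terms K I A"
| "\<lbrakk>s \<in> rb_terms K I A; t \<in> rb_terms K I A\<rbrakk> \<Longrightarrow> Plus s t \<in> rb_terms K I A"
| "\<lbrakk>c \<in> carrier K; t \<in> rb_terms K I A\<rbrakk> \<Longrightarrow> Scale c t \<in> rb_terms K I A"
| "\<lbrakk>i \<in> I; s \<in> rb_terms K I A; t \<in> rb_terms K I A\<rbrakk> \<Longrightarrow> Prod i s t \<in> rb_terms K I A"
| "t \<in> rb_terms K I A \<Longrightarrow> RB t \<in> rb_terms K I A"

primrec subst_mono :: "(nat \<Rightarrow> ('k, 'i, 'a) rb_term) \<Rightarrow> 'i monomial \<Rightarrow> ('k, 'i, 'a) rb_term" where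
  "subst_mono \<sigma> (Var k) = \<sigma> k"
| "subst_mono \<sigma> (Op i v w) = Prod i (subst_mono \<sigma> v) (subst_mono \<sigma> w)"

text \<open>
  Additive inverses are provided by \<open>Scale (\<ominus>\<^bsub>K\<^esub> \<one>\<^bsub>K\<^esub>)\<close>, in view of the rules \<open>l_distr\<close>, \<open>one\<close> and
  \<open>scale_zero\<close>. In the rule \<open>identity\<close>, the list \<open>us\<close> enumerates the support of \<open>f\<close>.
\<close>

inductive env_rel ::
  "('k, 'r) ring_scheme \<Rightarrow> 'i set \<Rightarrow> ('k, 'i) npoly set \<Rightarrow> ('k, 'a, 'i dend_op) alg
   \<Rightarrow> ('k, 'i, 'a) rb_term \<Rightarrow> ('k, 'i, 'a) rb_term \<Rightarrow> bool"
  for K I S A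
where
  refl: "t \<in> rb_terms K I A \<Longrightarrow> env_rel K I S A t t"
| sym: "env_rel K I S A s t \<Longrightarrow> env_rel K I S A t s"
| trans: "\<lbrakk>env_rel K I S A s t; env_rel K I S A t u\<rbrakk> \<Longrightarrow> env_rel K I S A s u"
| cong_plus: "\<lbrakk>env_rel K I S A s s'; env_rel K I S A t t'\<rbrakk>
    \<Longrightarrow> env_rel K I S A (Plus s t) (Plus s' t')"
| cong_scale: "\<lbrakk>c \<in> carrier K; env_rel K I S A t t'\<rbrakk>
    \<Longrightarrow> env_rel K I S A (Scale c t) (Scale c t')"
| cong_prod: "\<lbrakk>i \<in> I; env_rel K I S A s s'; env_rel K I S A t t'\<rbrakk>
    \<Longrightarrow> env_rel K I S A (Prod i s t) (Prod i s' t')"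
| cong_rb: "env_rel K I S A t t' \<Longrightarrow> env_rel K I S A (RB t) (RB t')"
| assoc: "\<lbrakk>s \<in> rb_terms K I A; t \<in> rb_terms K I A; u \<in> rb_terms K I A\<rbrakk>
    \<Longrightarrow> env_rel K I S A (Plus (Plus s t) u) (Plus s (Plus t u))"
| comm: "\<lbrakk>s \<in> rb_terms K I A; t \<in> rb_terms K I A\<rbrakk>
    \<Longrightarrow> env_rel K I S A (Plus s t) (Plus t s)"
| zero: "t \<in> rb_terms K I A \<Longrightarrow> env_rel K I S A (Plus Zero t) t"
| scale_zero: "t \<in> rb_terms K I A \<Longrightarrow> env_rel K I S A (Scale \<zero>\<^bsub>K\<^esub> t) Zero"
| l_distr: "\<lbrakk>c \<in> carrier K; d \<in> carrier K; t \<in> rb_terms K I A\<rbrakk>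
    \<Longrightarrow> env_rel K I S A (Scale (c \<oplus>\<^bsub>K\<^esub> d) t) (Plus (Scale c t) (Scale d t))"
| r_distr: "\<lbrakk>c \<in> carrier K; s \<in> rb_terms K I A; t \<in> rb_terms K I A\<rbrakk>
    \<Longrightarrow> env_rel K I S A (Scale c (Plus s t)) (Plus (Scale c s) (Scale c t))"
| scale_scale: "\<lbrakk>c \<in> carrier K; d \<in> carrier K; t \<in> rb_terms K I A\<rbrakk>
    \<Longrightarrow> env_rel K I S A (Scale (c \<otimes>\<^bsub>K\<^esub> d) t) (Scale c (Scale d t))"
| one: "t \<in> rb_terms K I A \<Longrightarrow> env_rel K I S A (Scale \<one>\<^bsub>K\<^esub> t) t"
| prod_plus_left: "\<lbrakk>i \<in> I; s \<in> rb_terms K I A; t \<in> rb_terms K I A; u \<in> rb_terms K I A\<rbrakk>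
    \<Longrightarrow> env_rel K I S A (Prod i (Plus s t) u) (Plus (Prod i s u) (Prod i t u))"
| prod_plus_right: "\<lbrakk>i \<in> I; s \<in> rb_terms K I A; t \<in> rb_terms K I A; u \<in> rb_terms K I A\<rbrakk>
    \<Longrightarrow> env_rel K I S A (Prod i u (Plus s t)) (Plus (Prod i u s) (Prod i u t))"
| prod_scale_left: "\<lbrakk>i \<in> I; c \<in> carrier K; s \<in> rb_terms K I A; t \<in> rb_terms K I A\<rbrakk>
    \<Longrightarrow> env_rel K I S A (Prod i (Scale c s) t) (Scale c (Prod i s t))"
| prod_scale_right: "\<lbrakk>i \<in> I; c \<in> carrier K; s \<in> rb_terms K I A; t \<in> rb_terms K I A\<rbrakk>
    \<Longrightarrow> env_rel K I S A (Prod i s (Scale c t)) (Scale c (Prod i s t))"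
| rb_plus: "\<lbrakk>s \<in> rb_terms K I A; t \<in> rb_terms K I A\<rbrakk>
    \<Longrightarrow> env_rel K I S A (RB (Plus s t)) (Plus (RB s) (RB t))"
| rb_scale: "\<lbrakk>c \<in> carrier K; t \<in> rb_terms K I A\<rbrakk>
    \<Longrightarrow> env_rel K I S A (RB (Scale c t)) (Scale c (RB t))"
| rota_baxter: "\<lbrakk>i \<in> I; s \<in> rb_terms K I A; t \<in> rb_terms K I A\<rbrakk>
    \<Longrightarrow> env_rel K I S A (Prod i (RB s) (RB t)) (RB (Plus (Prod i s (RB t)) (Prod i (RB s) t)))"
| identity: "\<lbrakk>f \<in> S; range \<sigma> \<subseteq> rb_terms K I A; distinct us; set us = support K f\<rbrakk>
    \<Longrightarrow> env_rel K I S A (foldr (\<lambda>u t. Plus (Scale (f u) (subst_mono \<sigma> u)) t) us Zero) Zero"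
| gen_plus: "\<lbrakk>a \<in> carrier A; b \<in> carrier A\<rbrakk>
    \<Longrightarrow> env_rel K I S A (Gen (a \<oplus>\<^bsub>A\<^esub> b)) (Plus (Gen a) (Gen b))"
| gen_scale: "\<lbrakk>c \<in> carrier K; a \<in> carrier A\<rbrakk>
    \<Longrightarrow> env_rel K I S A (Gen (c \<odot>\<^bsub>A\<^esub> a)) (Scale c (Gen a))"
| gen_vdash: "\<lbrakk>i \<in> I; a \<in> carrier A; b \<in> carrier A\<rbrakk>
    \<Longrightarrow> env_rel K I S A (Gen (opr A (Vdash i) a b)) (Prod i (RB (Gen a)) (Gen b))"
| gen_dashv: "\<lbrakk>i \<in> I; a \<in> carrier A; b \<in> carrier A\<rbrakk>
    \<Longrightarrow> env_rel K I S A (Gen (opr A (Dashv i) a b)) (Prod i (Gen a) (RB (Gen b)))"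

definition env_class ::
  "('k, 'r) ring_scheme \<Rightarrow> 'i set \<Rightarrow> ('k, 'i) npoly set \<Rightarrow> ('k, 'a, 'i dend_op) alg
   \<Rightarrow> ('k, 'i, 'a) rb_term \<Rightarrow> ('k, 'i, 'a) rb_term set"
where
  "env_class K I S A t = {s. env_rel K I S A t s}"

definition envelope ::
  "('k, 'r) ring_scheme \<Rightarrow> 'i set \<Rightarrow> ('k, 'i) npoly set \<Rightarrow> ('k, 'a, 'i dend_op) alg
   \<Rightarrow> ('k, ('k, 'i, 'a) rb_term set, 'i) rb_alg"
where
  "envelope K I S A =
     \<lparr>carrier = env_class K I S A ` rb_terms K I A,
      monoid.mult = undefined, one = undefined,
      zero = env_class K I S A Zero,
      add = (\<lambda>X Y. \<Union>s\<in>X. \<Union>t\<in>Y. env_class K I S A (Plus s t)),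
      smult = (\<lambda>c X. \<Union>t\<in>X. env_class K I S A (Scale c t)),
      opr = (\<lambda>i X Y. \<Union>s\<in>X. \<Union>t\<in>Y. env_class K I S A (Prod i s t)),
      rb = (\<lambda>X. \<Union>t\<in>X. env_class K I S A (RB t))\<rparr>"

definition canonical_map ::
  "('k, 'r) ring_scheme \<Rightarrow> 'i set \<Rightarrow> ('k, 'i) npoly set \<Rightarrow> ('k, 'a, 'i dend_op) alg
   \<Rightarrow> 'a \<Rightarrow> ('k, 'i, 'a) rb_term set"
where
  "canonical_map K I S A a = env_class K I S A (Gen a)"

end

theory Submission
  imports Defs
begin

text \<open>
  The sums \<open>\<turnstile>\<^sub>i + \<stileturn>\<^sub>i\<close> make \<open>A\<close> an algebra \<open>A\<^sup>+\<close>, and \<open>\<turnstile>\<^sub>i\<close>, \<open>\<stileturn>\<^sub>i\<close> make \<open>A\<close> a bimodule over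
  \<open>A\<^sup>+\<close>. On the null extension \<open>A\<^sup>+ \<oplus> A\<close>, the map \<open>R (a, m) = (m, 0)\<close> is a Rota-Baxter operator of
  weight zero, and \<open>a \<mapsto> (0, a)\<close> is an injective homomorphism of dendriform algebras. The defining
  identities of a dendriform algebra, summed over all distinguished variables, say precisely that the
  null extension satisfies the identities of the variety. An injective homomorphism into some
  Rota-Baxter algebra factors through the canonical map, which is therefore injective.
\<close>

section \<open>Linear maps and finite sums\<close>

lemma linear_mapsI:
  assumes "\<And>x. x \<in> carrier M \<Longrightarrow> h x \<in> carrier N"
    and "\<And>x y. \<lbrakk>x \<in> carrier M; y \<in> carrier M\<rbrakk> \<Longrightarrow> h (x \<oplus>\<^bsub>M\<^esub> y) = h x \<oplus>\<^bsub>N\<^esub> h y"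
    and "\<And>c x. \<lbrakk>c \<in> carrier K; x \<in> carrier M\<rbrakk> \<Longrightarrow> h (c \<odot>\<^bsub>M\<^esub> x) = c \<odot>\<^bsub>N\<^esub> h x"
  shows "h \<in> linear_maps K M N"
  using assms unfolding linear_maps_def by blast

lemma linear_mapsD:
  assumes "h \<in> linear_maps K M N"
  shows linear_maps_closed: "x \<in> carrier M \<Longrightarrow> h x \<in> carrier N"
    and linear_maps_add: "\<lbrakk>x \<in> carrier M; y \<in> carrier M\<rbrakk> \<Longrightarrow> h (x \<oplus>\<^bsub>M\<^esub> y) = h x \<oplus>\<^bsub>N\<^esub> h y"
    and linear_maps_smult: "\<lbrakk>c \<in> carrier K; x \<in> carrier M\<rbrakk> \<Longrightarrow> h (c \<odot>\<^bsub>M\<^esub> x) = c \<odot>\<^bsub>N\<^esub> h x"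
  using assms unfolding linear_maps_def by blast+

lemma linear_maps_zero:
  assumes "module K M" "module K N" "h \<in> linear_maps K M N"
  shows "h \<zero>\<^bsub>M\<^esub> = \<zero>\<^bsub>N\<^esub>"
proof -
  interpret M: module K M by fact
  interpret N: module K N by fact
  have "h \<zero>\<^bsub>M\<^esub> = h (\<zero>\<^bsub>K\<^esub> \<odot>\<^bsub>M\<^esub> \<zero>\<^bsub>M\<^esub>)" by simp
  also have "\<dots> = \<zero>\<^bsub>K\<^esub> \<odot>\<^bsub>N\<^esub> h \<zero>\<^bsub>M\<^esub>"
    using assms(3) by (intro linear_maps_smult) auto
  also have "\<dots> = \<zero>\<^bsub>N\<^esub>"
    using linear_maps_closed[OF assms(3)] by simp
  finally show ?thesis .
qed

lemma linear_maps_finsum: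
  assumes "module K M" "module K N" "h \<in> linear_maps K M N" "finite X" "f \<in> X \<rightarrow> carrier M"
  shows "h (\<Oplus>\<^bsub>M\<^esub>x\<in>X. f x) = (\<Oplus>\<^bsub>N\<^esub>x\<in>X. h (f x))"
proof -
  interpret M: module K M by fact
  interpret N: module K N by fact
  note h = linear_mapsD[OF assms(3)] linear_maps_zero[OF assms(1-3)]
  from assms(4,5) show ?thesis
  proof induction
    case (insert x X)
    then have "f x \<in> carrier M" "f \<in> X \<rightarrow> carrier M" by auto
    moreover from this have "(\<lambda>x. h (f x)) \<in> X \<rightarrow> carrier N" using h(1) by auto
    ultimately show ?case using insert by (simp add: h)
  qed (simp add: h)
qed

text \<open>Serves to exchange the sum over the monomials of an identity with the sum over its
  distinguished variables.\<close>

lemma (in abelian_monoid) finsum_swap: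
  assumes "finite X" "\<And>x y. \<lbrakk>x \<in> X; y \<in> Y\<rbrakk> \<Longrightarrow> f x y \<in> carrier G"
  shows "(\<Oplus>x\<in>X. \<Oplus>y\<in>Y. f x y) = (\<Oplus>y\<in>Y. \<Oplus>x\<in>X. f x y)"
  using assms
proof induction
  case (insert x X)
  then have "(\<Oplus>y\<in>Y. \<Oplus>x\<in>insert x X. f x y) = (\<Oplus>y\<in>Y. f x y \<oplus> (\<Oplus>x\<in>X. f x y))"
    by (intro finsum_cong' refl finsum_insert) (auto intro!: finsum_closed)
  also have "\<dots> = (\<Oplus>y\<in>Y. f x y) \<oplus> (\<Oplus>y\<in>Y. \<Oplus>x\<in>X. f x y)"
    using insert.prems by (intro finsum_addf) (auto intro!: finsum_closed)
  finally show ?case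
    using insert by (auto intro!: finsum_closed)
qed (simp add: finsum_zero)


section \<open>Evaluation of non-associative polynomials\<close>

lemma omega_algebraD:
  assumes "omega_algebra K J A"
  shows omega_algebra_module: "module K A"
    and opr_linear_right: "\<lbrakk>j \<in> J; x \<in> carrier A\<rbrakk> \<Longrightarrow> opr A j x \<in> linear_maps K A A"
    and opr_linear_left: "\<lbrakk>j \<in> J; x \<in> carrier A\<rbrakk> \<Longrightarrow> (\<lambda>y. opr A j y x) \<in> linear_maps K A A"
    and opr_closed: "\<lbrakk>j \<in> J; x \<in> carrier A; y \<in> carrier A\<rbrakk> \<Longrightarrow> opr A j x y \<in> carrier A"
  using assms linear_maps_closed unfolding omega_algebra_def by metis+

lemma eval_mono_closed:
  assumes "omega_algebra K J A" "range \<rho> \<subseteq> carrier A" "op_symbols u \<subseteq> J"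
  shows "eval_mono A \<rho> u \<in> carrier A"
  using assms(3)
proof (induction u)
  case (Var k)
  then show ?case using assms(2) by auto
next
  case (Op j v w)
  then show ?case using opr_closed[OF assms(1)] by simp
qed

text \<open>Serves for products: a distinguished variable lies in only one factor, so changing its
  value leaves the value of the other factor alone.\<close>

lemma eval_mono_cong:
  "(\<And>k. k \<in> set (vars u) \<Longrightarrow> \<rho> k = \<sigma> k) \<Longrightarrow> eval_mono A \<rho> u = eval_mono A \<sigma> u"
  by (induction u) auto

text \<open>Finite combinations of monomials over the symbols \<open>J\<close>. Unlike
  \<open>polylinear\<close>, this puts no condition on the variables, so it is stable under the sums
  and products from which \<open>star\<close> and \<open>Phi\<close> are built.\<close>

definition npolys :: "('k, 'r) ring_scheme \<Rightarrow> 'i set \<Rightarrow> ('k, 'i) npoly set" where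
  "npolys K J = {p. range p \<subseteq> carrier K \<and> finite (support K p) \<and>
     (\<forall>u\<in>support K p. op_symbols u \<subseteq> J)}"

lemma npolysD:
  assumes "p \<in> npolys K J"
  shows npolys_coeff: "p u \<in> carrier K"
    and npolys_finite: "finite (support K p)"
    and npolys_ops: "u \<in> support K p \<Longrightarrow> op_symbols u \<subseteq> J"
  using assms unfolding npolys_def by auto

lemma npolysI:
  assumes "\<And>u. p u \<in> carrier K" "finite (support K p)"
    and "\<And>u. u \<in> support K p \<Longrightarrow> op_symbols u \<subseteq> J"
  shows "p \<in> npolys K J"
  using assms unfolding npolys_def by blast

lemma polylinear_npolys: "polylinear K J n f \<Longrightarrow> f \<in> npolys K J"
  unfolding polylinear_def npolys_def by blast

section \<open>Evaluation as a homomorphism from polynomials to an algebra\<close>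

context
  fixes K :: "('k, 'r) ring_scheme" and J :: "'j set" and A :: "('k, 'a, 'j, 'm) alg_scheme"
    and \<rho> :: "nat \<Rightarrow> 'a"
  assumes omega: "omega_algebra K J A" and val: "range \<rho> \<subseteq> carrier A"
begin

interpretation A: module K A
  using omega by (rule omega_algebra_module)

text \<open>The extra terms have coefficient \<zero>. Such supersets are needed because coefficients
  may cancel in a sum or vanish in a product, so that the support is only contained in the natural
  index set.\<close>

lemma eval_poly_superset:
  assumes "p \<in> npolys K J" "finite T" "support K p \<subseteq> T" "\<And>u. u \<in> T \<Longrightarrow> op_symbols u \<subseteq> J"
  shows "eval_poly K A \<rho> p = (\<Oplus>\<^bsub>A\<^esub>u\<in>T. p u \<odot>\<^bsub>A\<^esub> eval_mono A \<rho> u)"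
  unfolding eval_poly_def using assms eval_mono_closed[OF omega val] npolys_coeff[OF assms(1)]
  by (intro A.add.finprod_mono_neutral_cong_left) (auto simp: support_def)

lemma eval_poly_closed: "p \<in> npolys K J \<Longrightarrow> eval_poly K A \<rho> p \<in> carrier A"
  unfolding eval_poly_def
  using eval_mono_closed[OF omega val] npolysD[of p K J]
  by (intro A.finsum_closed) blast

lemma pvar_npolys: "pvar K k \<in> npolys K J"
proof -
  have "support K (pvar K k) \<subseteq> {Var k}" by (auto simp: support_def pvar_def)
  then show ?thesis
    by (intro npolysI) (auto simp: pvar_def dest: finite_subset)
qed

lemma eval_poly_pvar: "eval_poly K A \<rho> (pvar K k) = \<rho> k"
proof -
  have "\<rho> k \<in> carrier A" using val by auto
  moreover have "support K (pvar K k) \<subseteq> {Var k}" by (auto simp: support_def pvar_def)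
  ultimately show ?thesis
    by (subst eval_poly_superset[of _ "{Var k}"]) (auto simp: pvar_npolys, simp add: pvar_def)
qed

lemma padd_npolys:
  assumes "p \<in> npolys K J" "q \<in> npolys K J"
  shows "padd K p q \<in> npolys K J" "support K (padd K p q) \<subseteq> support K p \<union> support K q"
proof -
  show sub: "support K (padd K p q) \<subseteq> support K p \<union> support K q"
    by (auto simp: support_def padd_def)
  show "padd K p q \<in> npolys K J"
  proof (rule npolysI)
    show "finite (support K (padd K p q))"
      using assms[THEN npolys_finite] finite_subset[OF sub] by simp
    show "op_symbols u \<subseteq> J" if "u \<in> support K (padd K p q)" for u
      using that sub assms[THEN npolys_ops] by blast
  qed (simp add: padd_def assms[THEN npolys_coeff])
qed

lemma eval_poly_padd:
  assumes "p \<in> npolys K J" "q \<in> npolys K J"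
  shows "eval_poly K A \<rho> (padd K p q) = eval_poly K A \<rho> p \<oplus>\<^bsub>A\<^esub> eval_poly K A \<rho> q"
proof -
  let ?T = "support K p \<union> support K q"
  have T: "finite ?T" "\<And>u. u \<in> ?T \<Longrightarrow> op_symbols u \<subseteq> J"
    using assms[THEN npolys_finite] assms[THEN npolys_ops] by (simp, blast)
  have cl: "eval_mono A \<rho> u \<in> carrier A" if "u \<in> ?T" for u
    using that T eval_mono_closed[OF omega val] by blast
  have "eval_poly K A \<rho> (padd K p q) =
      (\<Oplus>\<^bsub>A\<^esub>u\<in>?T. p u \<odot>\<^bsub>A\<^esub> eval_mono A \<rho> u \<oplus>\<^bsub>A\<^esub> q u \<odot>\<^bsub>A\<^esub> eval_mono A \<rho> u)"
    using npolys_coeff[OF assms(1)] npolys_coeff[OF assms(2)] cl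
    by (subst eval_poly_superset[OF padd_npolys(1)[OF assms] T(1) padd_npolys(2)[OF assms] T(2)])
      (auto intro!: A.finsum_cong' simp: padd_def A.smult_l_distr simp del: A.finsum_addf)
  also have "\<dots> = eval_poly K A \<rho> p \<oplus>\<^bsub>A\<^esub> eval_poly K A \<rho> q"
    using cl npolys_coeff[OF assms(1)] npolys_coeff[OF assms(2)]
    by (subst (1 2) eval_poly_superset[OF _ T(1) _ T(2)])
       (auto simp: assms intro!: A.finsum_addf)
  finally show ?thesis .
qed

lemma pscale_npolys:
  assumes "p \<in> npolys K J" "c \<in> carrier K"
  shows "(\<lambda>u. c \<otimes>\<^bsub>K\<^esub> p u) \<in> npolys K J" "support K (\<lambda>u. c \<otimes>\<^bsub>K\<^esub> p u) \<subseteq> support K p"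
proof -
  show sub: "support K (\<lambda>u. c \<otimes>\<^bsub>K\<^esub> p u) \<subseteq> support K p"
    using assms(2) by (auto simp: support_def)
  show "(\<lambda>u. c \<otimes>\<^bsub>K\<^esub> p u) \<in> npolys K J"
  proof (rule npolysI)
    show "finite (support K (\<lambda>u. c \<otimes>\<^bsub>K\<^esub> p u))"
      using npolys_finite[OF assms(1)] finite_subset[OF sub] by simp
    show "op_symbols u \<subseteq> J" if "u \<in> support K (\<lambda>u. c \<otimes>\<^bsub>K\<^esub> p u)" for u
      using that sub npolys_ops[OF assms(1)] by blast
  qed (simp add: assms(2) npolys_coeff[OF assms(1)])
qed

lemma eval_poly_pscale:
  assumes "p \<in> npolys K J" "c \<in> carrier K"
  shows "eval_poly K A \<rho> (\<lambda>u. c \<otimes>\<^bsub>K\<^esub> p u) = c \<odot>\<^bsub>A\<^esub> eval_poly K A \<rho> p"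
proof -
  have cl: "eval_mono A \<rho> u \<in> carrier A" if "u \<in> support K p" for u
    using that npolys_ops[OF assms(1)] eval_mono_closed[OF omega val] by blast
  have "eval_poly K A \<rho> (\<lambda>u. c \<otimes>\<^bsub>K\<^esub> p u) =
      (\<Oplus>\<^bsub>A\<^esub>u\<in>support K p. (c \<otimes>\<^bsub>K\<^esub> p u) \<odot>\<^bsub>A\<^esub> eval_mono A \<rho> u)"
    using npolysD[OF assms(1)] pscale_npolys[OF assms] by (intro eval_poly_superset) auto
  also have "\<dots> = (\<Oplus>\<^bsub>A\<^esub>u\<in>support K p. c \<odot>\<^bsub>A\<^esub> (p u \<odot>\<^bsub>A\<^esub> eval_mono A \<rho> u))"
    using cl npolys_coeff[OF assms(1)] assms(2)
    by (intro A.finsum_cong') (auto simp: A.smult_assoc1)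
  also have "\<dots> = c \<odot>\<^bsub>A\<^esub> eval_poly K A \<rho> p"
    unfolding eval_poly_def using cl npolysD[OF assms(1)] assms(2)
    by (intro A.finsum_smult_ldistr[symmetric]) auto
  finally show ?thesis .
qed

text \<open>Membership and evaluation go through one induction, because additivity of evaluation at
  each new summand presupposes membership of the remaining sum. With \<open>X\<close> the support of
  an identity, this is the shape of \<open>Phi\<close>.\<close>

lemma psum_npolys_eval:
  assumes "finite X" "\<And>x. x \<in> X \<Longrightarrow> P x \<in> npolys K J" "\<And>x. x \<in> X \<Longrightarrow> c x \<in> carrier K"
  shows "(\<lambda>m. \<Oplus>\<^bsub>K\<^esub>x\<in>X. c x \<otimes>\<^bsub>K\<^esub> P x m) \<in> npolys K J \<and>
    eval_poly K A \<rho> (\<lambda>m. \<Oplus>\<^bsub>K\<^esub>x\<in>X. c x \<otimes>\<^bsub>K\<^esub> P x m) = (\<Oplus>\<^bsub>A\<^esub>x\<in>X. c x \<odot>\<^bsub>A\<^esub> eval_poly K A \<rho> (P x))"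
  using assms
proof induction
  case empty
  have [simp]: "support K (\<lambda>m. \<zero>\<^bsub>K\<^esub>) = {}" by (auto simp: support_def)
  then show ?case by (auto simp: npolys_def eval_poly_def)
next
  case (insert x X)
  have P: "P y m \<in> carrier K" if "y \<in> insert x X" for y m
    using insert.prems(1)[OF that] by (rule npolys_coeff)
  have eq: "(\<lambda>m. \<Oplus>\<^bsub>K\<^esub>x\<in>insert x X. c x \<otimes>\<^bsub>K\<^esub> P x m) =
     padd K (\<lambda>m. c x \<otimes>\<^bsub>K\<^esub> P x m) (\<lambda>m. \<Oplus>\<^bsub>K\<^esub>x\<in>X. c x \<otimes>\<^bsub>K\<^esub> P x m)"
    unfolding padd_def using insert P by (intro ext A.R.finsum_insert) auto
  have "(\<Oplus>\<^bsub>A\<^esub>x\<in>insert x X. c x \<odot>\<^bsub>A\<^esub> eval_poly K A \<rho> (P x)) =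
     c x \<odot>\<^bsub>A\<^esub> eval_poly K A \<rho> (P x) \<oplus>\<^bsub>A\<^esub> (\<Oplus>\<^bsub>A\<^esub>x\<in>X. c x \<odot>\<^bsub>A\<^esub> eval_poly K A \<rho> (P x))"
    using insert by (intro A.finsum_insert) (auto intro!: A.smult_closed eval_poly_closed)
  moreover have IH: "(\<lambda>m. \<Oplus>\<^bsub>K\<^esub>x\<in>X. c x \<otimes>\<^bsub>K\<^esub> P x m) \<in> npolys K J"
    "eval_poly K A \<rho> (\<lambda>m. \<Oplus>\<^bsub>K\<^esub>x\<in>X. c x \<otimes>\<^bsub>K\<^esub> P x m) = (\<Oplus>\<^bsub>A\<^esub>x\<in>X. c x \<odot>\<^bsub>A\<^esub> eval_poly K A \<rho> (P x))"
    using insert by auto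
  ultimately show ?case
    unfolding eq using insert.prems pscale_npolys[of "P x" "c x"] padd_npolys(1)[OF _ IH(1)]
    by (simp add: eval_poly_padd[OF _ IH(1)] eval_poly_pscale IH(2))
qed

lemma pop_npolys:
  assumes "p \<in> npolys K J" "q \<in> npolys K J" "j \<in> J"
  shows "pop K j p q \<in> npolys K J" "support K (pop K j p q) \<subseteq> (\<Union>v\<in>support K p. Op j v ` support K q)"
proof -
  show sub: "support K (pop K j p q) \<subseteq> (\<Union>v\<in>support K p. Op j v ` support K q)"
  proof
    fix u assume "u \<in> support K (pop K j p q)"
    then show "u \<in> (\<Union>v\<in>support K p. Op j v ` support K q)"
      using A.R.l_null[OF npolys_coeff[OF assms(2)]] A.R.r_null[OF npolys_coeff[OF assms(1)]]
      by (cases u) (force simp: support_def pop_def split: if_splits)+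
  qed
  have "finite (support K (pop K j p q))"
    using npolys_finite[OF assms(1)] npolys_finite[OF assms(2)] by (intro finite_subset[OF sub]) auto
  moreover have "pop K j p q u \<in> carrier K" for u
    using npolys_coeff[OF assms(1)] npolys_coeff[OF assms(2)]
    by (cases u) (auto simp: pop_def)
  ultimately show "pop K j p q \<in> npolys K J"
    using sub npolys_ops[OF assms(1)] npolys_ops[OF assms(2)] assms(3) unfolding npolys_def
    by fastforce
qed

text \<open>By bilinearity both sides are a double sum over the supports of \<open>p\<close> and
  \<open>q\<close>. Since \<open>Op j\<close> determines its two factors, each product monomial
  comes from one pair only and no coefficients have to be collected.\<close>

lemma eval_poly_pop:
  assumes "p \<in> npolys K J" "q \<in> npolys K J" "j \<in> J"
  shows "eval_poly K A \<rho> (pop K j p q) = opr A j (eval_poly K A \<rho> p) (eval_poly K A \<rho> q)"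
proof -
  let ?P = "support K p" and ?Q = "support K q" and ?e = "eval_mono A \<rho>"
  let ?T = "\<Union>v\<in>?P. Op j v ` ?Q"
  note p = npolysD[OF assms(1)] and q = npolysD[OF assms(2)]
  note right = linear_mapsD[OF opr_linear_right[OF omega assms(3)]]
  note left = linear_mapsD[OF opr_linear_left[OF omega assms(3)]]
  have e: "?e u \<in> carrier A" if "op_symbols u \<subseteq> J" for u
    using that by (rule eval_mono_closed[OF omega val])
  have eq: "eval_poly K A \<rho> q \<in> carrier A" by (rule eval_poly_closed[OF assms(2)])
  have coeff: "pop K j p q u \<in> carrier K" for u
    by (rule npolys_coeff[OF pop_npolys(1)[OF assms]])
  have term_closed: "pop K j p q u \<odot>\<^bsub>A\<^esub> ?e u \<in> carrier A" if "u \<in> ?T" for u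
    using that p q assms(3) coeff by (intro A.smult_closed e) fastforce+
  have "eval_poly K A \<rho> (pop K j p q) = (\<Oplus>\<^bsub>A\<^esub>u\<in>?T. pop K j p q u \<odot>\<^bsub>A\<^esub> ?e u)"
    using p q assms(3) by (intro eval_poly_superset pop_npolys assms) fastforce+
  also have "\<dots> = (\<Oplus>\<^bsub>A\<^esub>v\<in>?P. \<Oplus>\<^bsub>A\<^esub>u\<in>Op j v ` ?Q. pop K j p q u \<odot>\<^bsub>A\<^esub> ?e u)"
    using p(2) q(2) term_closed
    by (intro A.add.finprod_UN_disjoint) (auto simp: pairwise_def disjnt_def)
  also have "\<dots> = (\<Oplus>\<^bsub>A\<^esub>v\<in>?P. opr A j (p v \<odot>\<^bsub>A\<^esub> ?e v) (eval_poly K A \<rho> q))"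
  proof (intro A.finsum_cong' refl)
    show "(\<lambda>v. opr A j (p v \<odot>\<^bsub>A\<^esub> ?e v) (eval_poly K A \<rho> q)) \<in> ?P \<rightarrow> carrier A"
      using p e eq opr_closed[OF omega assms(3)] by auto
  next
    fix v assume v: "v \<in> ?P"
    have pv: "p v \<odot>\<^bsub>A\<^esub> ?e v \<in> carrier A" using v p e by auto
    have "(\<Oplus>\<^bsub>A\<^esub>u\<in>Op j v ` ?Q. pop K j p q u \<odot>\<^bsub>A\<^esub> ?e u) =
        (\<Oplus>\<^bsub>A\<^esub>w\<in>?Q. pop K j p q (Op j v w) \<odot>\<^bsub>A\<^esub> ?e (Op j v w))"
      using v term_closed by (intro A.finsum_reindex) (auto simp: inj_on_def)
    also have "\<dots> = (\<Oplus>\<^bsub>A\<^esub>w\<in>?Q. opr A j (p v \<odot>\<^bsub>A\<^esub> ?e v) (q w \<odot>\<^bsub>A\<^esub> ?e w))"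
    proof (intro A.finsum_cong' refl)
      fix w assume w: "w \<in> ?Q"
      have vw: "?e v \<in> carrier A" "?e w \<in> carrier A" using v w p q e by auto
      show "pop K j p q (Op j v w) \<odot>\<^bsub>A\<^esub> ?e (Op j v w) = opr A j (p v \<odot>\<^bsub>A\<^esub> ?e v) (q w \<odot>\<^bsub>A\<^esub> ?e w)"
        using vw p(1) q(1)
        by (simp add: pop_def A.smult_assoc1[symmetric] A.R.m_comm right(3) left(3) opr_closed[OF omega assms(3)])
    qed (use q e pv opr_closed[OF omega assms(3)] in auto)
    also have "\<dots> = opr A j (p v \<odot>\<^bsub>A\<^esub> ?e v) (eval_poly K A \<rho> q)"
      unfolding eval_poly_def using q e
      by (intro linear_maps_finsum[symmetric, OF A.module_axioms A.module_axioms
          opr_linear_right[OF omega assms(3) pv]]) auto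
    finally show "(\<Oplus>\<^bsub>A\<^esub>u\<in>Op j v ` ?Q. pop K j p q u \<odot>\<^bsub>A\<^esub> ?e u) =
      opr A j (p v \<odot>\<^bsub>A\<^esub> ?e v) (eval_poly K A \<rho> q)" .
  qed simp
  also have "\<dots> = opr A j (eval_poly K A \<rho> p) (eval_poly K A \<rho> q)"
    unfolding eval_poly_def[of _ _ _ p] using p e
    by (intro linear_maps_finsum[symmetric, OF A.module_axioms A.module_axioms
          opr_linear_left[OF omega assms(3) eq]]) auto
  finally show ?thesis .
qed

end


section \<open>The null extension of a dendriform algebra\<close>

definition plus_alg :: "('k, 'a, 'i dend_op) alg \<Rightarrow> ('k, 'a, 'i) alg" where
  "plus_alg A = \<lparr>carrier = carrier A, monoid.mult = monoid.mult A, one = one A, zero = zero A,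
     add = add A, smult = smult A,
     opr = (\<lambda>i x y. opr A (Vdash i) x y \<oplus>\<^bsub>A\<^esub> opr A (Dashv i) x y)\<rparr>"

lemma opr_plus_alg [simp]:
  "opr (plus_alg A) i x y = opr A (Vdash i) x y \<oplus>\<^bsub>A\<^esub> opr A (Dashv i) x y"
  by (simp add: plus_alg_def)

text \<open>The recursion of \<open>Phi_mono\<close> carried out on values in \<open>A\<close>, with
  \<open>star\<close> replaced by evaluation in \<open>plus_alg A\<close>. As there, the case
  distinction presumes that \<open>k\<close> occurs exactly once.\<close>

primrec Phi_eval :: "('k, 'a, 'i dend_op) alg \<Rightarrow> nat \<Rightarrow> (nat \<Rightarrow> 'a) \<Rightarrow> 'i monomial \<Rightarrow> 'a" where
  "Phi_eval A k \<rho> (Var j) = \<rho> j"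
| "Phi_eval A k \<rho> (Op i v w) =
     (if k \<in> set (vars w) then opr A (Vdash i) (eval_mono (plus_alg A) \<rho> v) (Phi_eval A k \<rho> w)
      else opr A (Dashv i) (Phi_eval A k \<rho> v) (eval_mono (plus_alg A) \<rho> w))"

text \<open>The split null extension of \<open>plus_alg A\<close> by the bimodule \<open>A\<close>:
  no product of two second components occurs, so these form an ideal of square zero. The operator
  sends this ideal onto its copy in the first component and kills that component.\<close>

definition null_ext :: "('k, 'a, 'i dend_op) alg \<Rightarrow> ('k, 'a \<times> 'a, 'i) rb_alg" where
  "null_ext A = \<lparr>carrier = carrier A \<times> carrier A, monoid.mult = undefined, one = undefined,
     zero = (\<zero>\<^bsub>A\<^esub>, \<zero>\<^bsub>A\<^esub>),
     add = (\<lambda>x y. (fst x \<oplus>\<^bsub>A\<^esub> fst y, snd x \<oplus>\<^bsub>A\<^esub> snd y)),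
     smult = (\<lambda>c x. (c \<odot>\<^bsub>A\<^esub> fst x, c \<odot>\<^bsub>A\<^esub> snd x)),
     opr = (\<lambda>i x y. (opr (plus_alg A) i (fst x) (fst y),
       opr A (Vdash i) (fst x) (snd y) \<oplus>\<^bsub>A\<^esub> opr A (Dashv i) (snd x) (fst y))),
     rb = (\<lambda>x. (snd x, \<zero>\<^bsub>A\<^esub>))\<rparr>"

lemma null_ext_simps [simp]:
  "carrier (null_ext A) = carrier A \<times> carrier A"
  "\<zero>\<^bsub>null_ext A\<^esub> = (\<zero>\<^bsub>A\<^esub>, \<zero>\<^bsub>A\<^esub>)"
  "x \<oplus>\<^bsub>null_ext A\<^esub> y = (fst x \<oplus>\<^bsub>A\<^esub> fst y, snd x \<oplus>\<^bsub>A\<^esub> snd y)"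
  "c \<odot>\<^bsub>null_ext A\<^esub> x = (c \<odot>\<^bsub>A\<^esub> fst x, c \<odot>\<^bsub>A\<^esub> snd x)"
  "opr (null_ext A) i x y = (opr A (Vdash i) (fst x) (fst y) \<oplus>\<^bsub>A\<^esub> opr A (Dashv i) (fst x) (fst y),
     opr A (Vdash i) (fst x) (snd y) \<oplus>\<^bsub>A\<^esub> opr A (Dashv i) (snd x) (fst y))"
  "rb (null_ext A) x = (snd x, \<zero>\<^bsub>A\<^esub>)"
  by (simp_all add: null_ext_def)

text \<open>The first projection is a homomorphism to \<open>plus_alg A\<close>.\<close>

lemma eval_mono_null_ext_fst:
  "fst (eval_mono (null_ext A) \<rho> u) = eval_mono (plus_alg A) (fst \<circ> \<rho>) u"
  by (induction u) simp_all

text \<open>The diagonal is a homomorphism from \<open>plus_alg A\<close> to the null extension: on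
  diagonal elements both components of a product are the same sum. Facts on
  \<open>plus_alg A\<close> can thus be read off second components.\<close>

lemma eval_mono_null_ext_diag:
  "eval_mono (null_ext A) (\<lambda>k. (\<rho> k, \<rho> k)) u = (eval_mono (plus_alg A) \<rho> u, eval_mono (plus_alg A) \<rho> u)"
  by (induction u) simp_all

section \<open>Algebra structure, identities and operator of the null extension\<close>

context
  fixes K :: "('k, 'r) ring_scheme" and I :: "'i set" and A :: "('k, 'a, 'i dend_op) alg"
  assumes omega: "omega_algebra K (dend_ops I) A"
begin

interpretation A: module K A
  using omega by (rule omega_algebra_module)

lemma Vdash_linear:
  assumes "i \<in> I"
  shows "\<And>x. x \<in> carrier A \<Longrightarrow> opr A (Vdash i) x \<in> linear_maps K A A"
    and "\<And>x. x \<in> carrier A \<Longrightarrow> (\<lambda>y. opr A (Vdash i) y x) \<in> linear_maps K A A"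
  using omega assms by (auto simp: dend_ops_def omega_algebra_def)

lemma Dashv_linear:
  assumes "i \<in> I"
  shows "\<And>x. x \<in> carrier A \<Longrightarrow> opr A (Dashv i) x \<in> linear_maps K A A"
    and "\<And>x. x \<in> carrier A \<Longrightarrow> (\<lambda>y. opr A (Dashv i) y x) \<in> linear_maps K A A"
  using omega assms by (auto simp: dend_ops_def omega_algebra_def)

lemmas Vdash = linear_mapsD[OF Vdash_linear(1)] linear_mapsD[OF Vdash_linear(2)]
  linear_maps_zero[OF A.module_axioms A.module_axioms Vdash_linear(1)]
  linear_maps_zero[OF A.module_axioms A.module_axioms Vdash_linear(2)]
lemmas Dashv = linear_mapsD[OF Dashv_linear(1)] linear_mapsD[OF Dashv_linear(2)]
  linear_maps_zero[OF A.module_axioms A.module_axioms Dashv_linear(1)]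
  linear_maps_zero[OF A.module_axioms A.module_axioms Dashv_linear(2)]

lemma omega_algebra_null_ext: "omega_algebra K I (null_ext A)"
  unfolding omega_algebra_def
proof (intro conjI ballI)
  show "module K (null_ext A)"
  proof (rule moduleI)
    show "abelian_group (null_ext A)"
    proof (rule abelian_groupI)
      fix x assume "x \<in> carrier (null_ext A)"
      then show "\<exists>y\<in>carrier (null_ext A). y \<oplus>\<^bsub>null_ext A\<^esub> x = \<zero>\<^bsub>null_ext A\<^esub>"
        by (intro bexI[of _ "(\<ominus>\<^bsub>A\<^esub> fst x, \<ominus>\<^bsub>A\<^esub> snd x)"]) (auto simp: A.l_neg)
    qed (auto simp: A.M.a_ac)
  qed (auto simp: A.smult_l_distr A.smult_r_distr A.smult_assoc1 A.R.is_cring)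
next
  fix i x assume "i \<in> I" "x \<in> carrier (null_ext A)"
  then show "opr (null_ext A) i x \<in> linear_maps K (null_ext A) (null_ext A)"
    "(\<lambda>y. opr (null_ext A) i y x) \<in> linear_maps K (null_ext A) (null_ext A)"
    by (auto intro!: linear_mapsI simp: Vdash Dashv A.smult_r_distr A.M.a_ac)
qed

lemma eval_mono_plus_closed:
  assumes "range \<rho> \<subseteq> carrier A" "op_symbols u \<subseteq> I"
  shows "eval_mono (plus_alg A) \<rho> u \<in> carrier A"
proof -
  have "eval_mono (null_ext A) (\<lambda>k. (\<rho> k, \<rho> k)) u \<in> carrier (null_ext A)"
    using assms by (intro eval_mono_closed[OF omega_algebra_null_ext]) auto
  then show ?thesis by (simp add: eval_mono_null_ext_diag)
qed

lemma Phi_eval_closed: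
  assumes "range \<rho> \<subseteq> carrier A" "op_symbols u \<subseteq> I"
  shows "Phi_eval A k \<rho> u \<in> carrier A"
  using assms(2)
proof (induction u)
  case (Var j)
  then show ?case using assms(1) by auto
next
  case (Op i v w)
  then show ?case
    using eval_mono_plus_closed[OF assms(1)] by (auto simp: Vdash(1) Dashv(1))
qed

text \<open>Splitting each operation into its two halves is what \<open>star\<close> does formally
  and \<open>plus_alg A\<close> does on values. Membership is part of the induction since the
  evaluation of \<open>pop\<close> and \<open>padd\<close> presupposes it.\<close>

lemma star_eval:
  assumes "range \<rho> \<subseteq> carrier A" "op_symbols u \<subseteq> I"
  shows "star K u \<in> npolys K (dend_ops I) \<and>
    eval_poly K A \<rho> (star K u) = eval_mono (plus_alg A) \<rho> u"
  using assms(2)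
proof (induction u)
  case (Var j)
  then show ?case
    by (simp add: pvar_npolys[OF omega assms(1)] eval_poly_pvar[OF omega assms(1)])
next
  case (Op i v w)
  have "Vdash i \<in> dend_ops I" "Dashv i \<in> dend_ops I" using Op.prems by (auto simp: dend_ops_def)
  with Op show ?case
    by (simp add: pop_npolys[OF omega assms(1)] eval_poly_pop[OF omega assms(1)]
        padd_npolys[OF omega assms(1)] eval_poly_padd[OF omega assms(1)])
qed

lemma Phi_mono_eval:
  assumes "range \<rho> \<subseteq> carrier A" "op_symbols u \<subseteq> I"
  shows "Phi_mono K k u \<in> npolys K (dend_ops I) \<and>
    eval_poly K A \<rho> (Phi_mono K k u) = Phi_eval A k \<rho> u"
  using assms(2)
proof (induction u)
  case (Var j)
  then show ?case
    by (simp add: pvar_npolys[OF omega assms(1)] eval_poly_pvar[OF omega assms(1)])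
next
  case (Op i v w)
  have "Vdash i \<in> dend_ops I" "Dashv i \<in> dend_ops I" using Op.prems by (auto simp: dend_ops_def)
  with Op show ?case
    by (simp add: pop_npolys[OF omega assms(1)] eval_poly_pop[OF omega assms(1)]
        star_eval[OF assms(1)])
qed

text \<open>Turns a dendriform identity into a sum over the monomials of \<open>f\<close> itself,
  the index set over which \<open>f\<close> is evaluated in the null extension.\<close>

lemma Phi_eval_poly:
  assumes "range \<rho> \<subseteq> carrier A" "f \<in> npolys K I"
  shows "eval_poly K A \<rho> (Phi K k f) = (\<Oplus>\<^bsub>A\<^esub>u\<in>support K f. f u \<odot>\<^bsub>A\<^esub> Phi_eval A k \<rho> u)"
proof -
  note f = npolysD[OF assms(2)]
  have "eval_poly K A \<rho> (Phi K k f) =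
      (\<Oplus>\<^bsub>A\<^esub>u\<in>support K f. f u \<odot>\<^bsub>A\<^esub> eval_poly K A \<rho> (Phi_mono K k u))"
    unfolding Phi_def using f Phi_mono_eval[OF assms(1)]
    by (intro psum_npolys_eval[OF omega assms(1), THEN conjunct2]) auto
  also have "\<dots> = (\<Oplus>\<^bsub>A\<^esub>u\<in>support K f. f u \<odot>\<^bsub>A\<^esub> Phi_eval A k \<rho> u)"
    using f Phi_mono_eval[OF assms(1)] Phi_eval_closed[OF assms(1)]
    by (intro A.M.finsum_cong') auto
  finally show ?thesis .
qed

text \<open>
  A product of two elements of the null ideal is zero, so in the second component of the value of a
  monomial exactly one variable contributes its second component.
\<close>

lemma eval_mono_null_ext_snd:
  assumes "range \<rho> \<subseteq> carrier (null_ext A)" "op_symbols u \<subseteq> I" "distinct (vars u)"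
  shows "snd (eval_mono (null_ext A) \<rho> u) =
    (\<Oplus>\<^bsub>A\<^esub>k\<in>set (vars u). Phi_eval A k ((fst \<circ> \<rho>)(k := snd (\<rho> k))) u)"
  using assms(2,3)
proof (induction u)
  case (Var k)
  have "\<rho> k \<in> carrier (null_ext A)" using assms(1) by blast
  then show ?case by (auto simp: mem_Times_iff)
next
  case (Op i v w)
  \<comment> \<open>First components everywhere, except that the distinguished variable
    \<open>k\<close> takes its second component.\<close>
  let ?\<rho> = "\<lambda>k. (fst \<circ> \<rho>)(k := snd (\<rho> k))"
  have i: "i \<in> I" and v: "op_symbols v \<subseteq> I" and w: "op_symbols w \<subseteq> I"
    and disj: "set (vars v) \<inter> set (vars w) = {}"
    using Op.prems by auto
  have "\<rho> k \<in> carrier A \<times> carrier A" for k using assms(1) by auto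
  then have val: "range (fst \<circ> \<rho>) \<subseteq> carrier A" "range (?\<rho> k) \<subseteq> carrier A" for k
    by (auto simp: mem_Times_iff)
  note cl = eval_mono_plus_closed[OF val(1)] Phi_eval_closed[OF val(2)]
  \<comment> \<open>The variables are split by the factor containing them. The right factor comes
    first, to match the order of the summands in the second component of a product.\<close>
  have "(\<Oplus>\<^bsub>A\<^esub>k\<in>set (vars (Op i v w)). Phi_eval A k (?\<rho> k) (Op i v w)) =
      (\<Oplus>\<^bsub>A\<^esub>k\<in>set (vars w). Phi_eval A k (?\<rho> k) (Op i v w)) \<oplus>\<^bsub>A\<^esub>
      (\<Oplus>\<^bsub>A\<^esub>k\<in>set (vars v). Phi_eval A k (?\<rho> k) (Op i v w))"
    using disj Phi_eval_closed[OF val(2) Op.prems(1)]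
    by (subst A.M.finsum_Un_disjoint[symmetric]) (auto simp: Un_commute)
  also have "(\<Oplus>\<^bsub>A\<^esub>k\<in>set (vars w). Phi_eval A k (?\<rho> k) (Op i v w)) =
      (\<Oplus>\<^bsub>A\<^esub>k\<in>set (vars w). opr A (Vdash i) (eval_mono (plus_alg A) (fst \<circ> \<rho>) v) (Phi_eval A k (?\<rho> k) w))"
  proof (intro A.M.finsum_cong')
    fix k assume k: "k \<in> set (vars w)"
    have "eval_mono (plus_alg A) (?\<rho> k) v = eval_mono (plus_alg A) (fst \<circ> \<rho>) v"
      using k disj by (intro eval_mono_cong) auto
    with k show "Phi_eval A k (?\<rho> k) (Op i v w) =
      opr A (Vdash i) (eval_mono (plus_alg A) (fst \<circ> \<rho>) v) (Phi_eval A k (?\<rho> k) w)"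
      by simp
  qed (use i v w cl in \<open>auto simp: Vdash(1)\<close>)
  \<comment> \<open>The value of \<open>v\<close> no longer depends on \<open>k\<close>, so
    linearity moves the sum into the right argument.\<close>
  also have "\<dots> = opr A (Vdash i) (eval_mono (plus_alg A) (fst \<circ> \<rho>) v) (\<Oplus>\<^bsub>A\<^esub>k\<in>set (vars w). Phi_eval A k (?\<rho> k) w)"
    using v w cl by (intro linear_maps_finsum[symmetric, OF A.module_axioms A.module_axioms Vdash_linear(1)[OF i]]) auto
  also have "(\<Oplus>\<^bsub>A\<^esub>k\<in>set (vars v). Phi_eval A k (?\<rho> k) (Op i v w)) =
      (\<Oplus>\<^bsub>A\<^esub>k\<in>set (vars v). opr A (Dashv i) (Phi_eval A k (?\<rho> k) v) (eval_mono (plus_alg A) (fst \<circ> \<rho>) w))"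
  proof (intro A.M.finsum_cong')
    fix k assume k: "k \<in> set (vars v)"
    \<comment> \<open>\<open>Phi_eval\<close> looks only into the right factor; disjointness of the
      variables selects the branch of the left one.\<close>
    then have "k \<notin> set (vars w)" using disj by auto
    moreover from this have "eval_mono (plus_alg A) (?\<rho> k) w = eval_mono (plus_alg A) (fst \<circ> \<rho>) w"
      by (intro eval_mono_cong) auto
    ultimately show "Phi_eval A k (?\<rho> k) (Op i v w) =
      opr A (Dashv i) (Phi_eval A k (?\<rho> k) v) (eval_mono (plus_alg A) (fst \<circ> \<rho>) w)"
      by simp
  qed (use i v w cl in \<open>auto simp: Dashv(1)\<close>)
  also have "\<dots> = opr A (Dashv i) (\<Oplus>\<^bsub>A\<^esub>k\<in>set (vars v). Phi_eval A k (?\<rho> k) v) (eval_mono (plus_alg A) (fst \<circ> \<rho>) w)"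
    using v w cl by (intro linear_maps_finsum[symmetric, OF A.module_axioms A.module_axioms Dashv_linear(2)[OF i]]) auto
  finally have eq: "(\<Oplus>\<^bsub>A\<^esub>k\<in>set (vars (Op i v w)). Phi_eval A k (?\<rho> k) (Op i v w)) =
      opr A (Vdash i) (eval_mono (plus_alg A) (fst \<circ> \<rho>) v) (\<Oplus>\<^bsub>A\<^esub>k\<in>set (vars w). Phi_eval A k (?\<rho> k) w) \<oplus>\<^bsub>A\<^esub>
      opr A (Dashv i) (\<Oplus>\<^bsub>A\<^esub>k\<in>set (vars v). Phi_eval A k (?\<rho> k) v) (eval_mono (plus_alg A) (fst \<circ> \<rho>) w)" .
  have "snd (eval_mono (null_ext A) \<rho> v) = (\<Oplus>\<^bsub>A\<^esub>k\<in>set (vars v). Phi_eval A k (?\<rho> k) v)"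
    "snd (eval_mono (null_ext A) \<rho> w) = (\<Oplus>\<^bsub>A\<^esub>k\<in>set (vars w). Phi_eval A k (?\<rho> k) w)"
    using Op.prems by (simp_all add: Op.IH del: fun_upd_apply comp_apply)
  then show ?case
    unfolding eq by (simp only: eval_mono.simps null_ext_simps snd_conv eval_mono_null_ext_fst)
qed

text \<open>In the second component, poly-linearity gives one contribution for each monomial and
  each distinguished variable. For fixed \<open>k\<close>, the sum over the monomials is the value
  of \<open>Phi K k f\<close>, which vanishes. The first component is reduced to this case.\<close>

lemma satisfies_null_ext:
  assumes f: "polylinear K I n f" and Phi: "\<And>k. k \<in> {1..n} \<Longrightarrow> satisfies K A (Phi K k f)"
  shows "satisfies K (null_ext A) f"
  unfolding satisfies_def
proof (intro allI impI)
  note mod = omega_algebra_module[OF omega_algebra_null_ext] A.module_axioms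
  note fp = polylinear_npolys[OF f]
  note fD = npolysD[OF fp]
  have u: "distinct (vars u)" "set (vars u) = {1..n}" if "u \<in> support K f" for u
    using f that unfolding polylinear_def by auto
  have proj: "fst \<in> linear_maps K (null_ext A) A" "snd \<in> linear_maps K (null_ext A) A"
    by (auto intro!: linear_mapsI)
  have project: "h (eval_poly K (null_ext A) \<rho> f) =
      (\<Oplus>\<^bsub>A\<^esub>u\<in>support K f. f u \<odot>\<^bsub>A\<^esub> h (eval_mono (null_ext A) \<rho> u))"
    if h: "h \<in> linear_maps K (null_ext A) A" and \<rho>: "range \<rho> \<subseteq> carrier (null_ext A)" for h \<rho>
  proof -
    interpret N: module K "null_ext A" by (rule mod)
    have cl: "eval_mono (null_ext A) \<rho> u \<in> carrier (null_ext A)" if "u \<in> support K f" for u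
      using fD(3)[OF that] by (rule eval_mono_closed[OF omega_algebra_null_ext \<rho>])
    have "h (eval_poly K (null_ext A) \<rho> f) =
        (\<Oplus>\<^bsub>A\<^esub>u\<in>support K f. h (f u \<odot>\<^bsub>null_ext A\<^esub> eval_mono (null_ext A) \<rho> u))"
      unfolding eval_poly_def using fD cl
      by (intro linear_maps_finsum[OF mod h] Pi_I N.smult_closed)
    also have "\<dots> = (\<Oplus>\<^bsub>A\<^esub>u\<in>support K f. f u \<odot>\<^bsub>A\<^esub> h (eval_mono (null_ext A) \<rho> u))"
      by (intro A.M.finsum_cong' refl Pi_I)
        (simp_all add: fD cl linear_mapsD[OF h] del: null_ext_simps)
    finally show ?thesis .
  qed
  have snd0: "snd (eval_poly K (null_ext A) \<rho> f) = \<zero>\<^bsub>A\<^esub>"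
    if \<rho>: "range \<rho> \<subseteq> carrier (null_ext A)" for \<rho>
  proof -
    let ?\<rho> = "\<lambda>k. (fst \<circ> \<rho>)(k := snd (\<rho> k))"
    have "\<rho> k \<in> carrier A \<times> carrier A" for k using \<rho> by auto
    then have val: "range (?\<rho> k) \<subseteq> carrier A" for k
      by (auto simp: mem_Times_iff)
    have cl: "Phi_eval A k (?\<rho> k) u \<in> carrier A" if "u \<in> support K f" for k u
      using fD(3)[OF that] by (rule Phi_eval_closed[OF val])
    have "snd (eval_poly K (null_ext A) \<rho> f) =
        (\<Oplus>\<^bsub>A\<^esub>u\<in>support K f. f u \<odot>\<^bsub>A\<^esub> snd (eval_mono (null_ext A) \<rho> u))"
      by (rule project[OF proj(2) \<rho>])
    \<comment> \<open>All monomials of \<open>f\<close> have the same variables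
      \<open>{1..n}\<close>, so the inner sum runs over a fixed set and the two sums can be
      exchanged.\<close>
    also have "\<dots> = (\<Oplus>\<^bsub>A\<^esub>u\<in>support K f. \<Oplus>\<^bsub>A\<^esub>k\<in>{1..n}. f u \<odot>\<^bsub>A\<^esub> Phi_eval A k (?\<rho> k) u)"
      using u fD cl eval_mono_null_ext_snd[OF \<rho>]
      by (intro A.M.finsum_cong' refl) (auto simp: A.finsum_smult_ldistr intro!: A.M.finsum_closed)
    also have "\<dots> = (\<Oplus>\<^bsub>A\<^esub>k\<in>{1..n}. \<Oplus>\<^bsub>A\<^esub>u\<in>support K f. f u \<odot>\<^bsub>A\<^esub> Phi_eval A k (?\<rho> k) u)"
      using fD cl by (intro A.M.finsum_swap A.smult_closed)
    also have "\<dots> = (\<Oplus>\<^bsub>A\<^esub>k\<in>{1..n}. \<zero>\<^bsub>A\<^esub>)"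
    proof (intro A.M.finsum_cong' refl)
      fix k assume "k \<in> {1..n}"
      then have "eval_poly K A (?\<rho> k) (Phi K k f) = \<zero>\<^bsub>A\<^esub>"
        using Phi val unfolding satisfies_def by blast
      then show "(\<Oplus>\<^bsub>A\<^esub>u\<in>support K f. f u \<odot>\<^bsub>A\<^esub> Phi_eval A k (?\<rho> k) u) = \<zero>\<^bsub>A\<^esub>"
        by (simp add: Phi_eval_poly[OF val fp])
    qed auto
    finally show ?thesis by simp
  qed
  fix \<rho> :: "nat \<Rightarrow> 'a \<times> 'a" assume \<rho>: "range \<rho> \<subseteq> carrier (null_ext A)"
  let ?d = "\<lambda>k. ((fst \<circ> \<rho>) k, (fst \<circ> \<rho>) k)"
  have d: "range ?d \<subseteq> carrier (null_ext A)" using \<rho> by (auto simp: image_subset_iff mem_Times_iff)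
  \<comment> \<open>The first component of \<open>f\<close> at \<open>\<rho>\<close> is the second one at the diagonal valuation \<open>?d\<close>.\<close>
  have "fst (eval_poly K (null_ext A) \<rho> f) = snd (eval_poly K (null_ext A) ?d f)"
    unfolding project[OF proj(1) \<rho>] project[OF proj(2) d] eval_mono_null_ext_fst eval_mono_null_ext_diag
    by (simp add: comp_def)
  with snd0[OF \<rho>] snd0[OF d] show "eval_poly K (null_ext A) \<rho> f = \<zero>\<^bsub>null_ext A\<^esub>"
    by (simp add: prod_eq_iff)
qed

text \<open>For pairs with second components \<open>m\<close> and \<open>n\<close>, both sides of
  the Rota-Baxter identity have first component \<open>m \<turnstile> n + m \<stileturn> n\<close>
  and second component \<zero>.\<close>

lemma rota_baxter_null_ext:
  assumes "\<And>f. f \<in> S \<Longrightarrow> satisfies K (null_ext A) f"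
  shows "rota_baxter_Var K I S (null_ext A)"
  unfolding rota_baxter_Var_def in_Var_def
  using assms omega_algebra_null_ext
  by (auto intro!: linear_mapsI simp: Vdash Dashv A.M.a_comm)

text \<open>The operator maps \<open>(\<zero>, a)\<close> to \<open>(a, \<zero>)\<close>, which acts
  on \<open>(\<zero>, b)\<close> from the left by \<open>Vdash i\<close> and from the right by
  \<open>Dashv i\<close>.\<close>

lemma null_ext_embedding: "(\<lambda>a. (\<zero>\<^bsub>A\<^esub>, a)) \<in> alg_hom K (dend_ops I) A (dend (null_ext A))"
  unfolding alg_hom_def
  by (auto intro!: linear_mapsI simp: dend_def dend_ops_def Vdash Dashv)

end


section \<open>The universal enveloping Rota-Baxter algebra\<close>

text \<open>The homomorphism from the term algebra to \<open>B\<close> that extends \<open>h\<close>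
  on generators; on well-formed terms it turns out to be constant on classes.\<close>

primrec interp ::
  "('k, 'b, 'i, 'm) rb_alg_scheme \<Rightarrow> ('a \<Rightarrow> 'b) \<Rightarrow> ('k, 'i, 'a) rb_term \<Rightarrow> 'b" where
  "interp B h (Gen a) = h a"
| "interp B h Zero = \<zero>\<^bsub>B\<^esub>"
| "interp B h (Plus s t) = interp B h s \<oplus>\<^bsub>B\<^esub> interp B h t"
| "interp B h (Scale c t) = c \<odot>\<^bsub>B\<^esub> interp B h t"
| "interp B h (Prod i s t) = opr B i (interp B h s) (interp B h t)"
| "interp B h (RB t) = rb B (interp B h t)"

lemma interp_subst_mono: "interp B h (subst_mono \<sigma> u) = eval_mono B (\<lambda>k. interp B h (\<sigma> k)) u"
  by (induction u) simp_all

section \<open>The congruence on terms and the algebra of its classes\<close>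

context
  fixes K :: "('k, 'r) ring_scheme" and I :: "'i set" and S :: "('k, 'i) npoly set"
    and A :: "('k, 'a, 'i dend_op) alg"
  assumes omega: "omega_algebra K (dend_ops I) A" and S: "S \<subseteq> npolys K I"
begin

interpretation A: module K A
  using omega by (rule omega_algebra_module)

abbreviation (input) "TT \<equiv> rb_terms K I A"
abbreviation (input) "EE \<equiv> env_rel K I S A"
abbreviation (input) "CC \<equiv> env_class K I S A"
abbreviation (input) "UU \<equiv> envelope K I S A"

lemma subst_mono_terms:
  "\<lbrakk>range \<sigma> \<subseteq> TT; op_symbols u \<subseteq> I\<rbrakk> \<Longrightarrow> subst_mono \<sigma> u \<in> TT"
  by (induction u) (auto intro: rb_terms.intros)

lemma foldr_terms:
  assumes "range \<sigma> \<subseteq> TT" "f \<in> npolys K I" "set us \<subseteq> support K f"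
  shows "foldr (\<lambda>u t. Plus (Scale (f u) (subst_mono \<sigma> u)) t) us Zero \<in> TT"
  using assms(3)
proof (induction us)
  case (Cons u us)
  then show ?case
    using npolysD[OF assms(2)]
    by (auto intro!: rb_terms.intros subst_mono_terms[OF assms(1)])
qed (simp add: rb_terms.intros)

text \<open>Lets equality of classes follow from the relation without side conditions. For the rules
  on identities and generators it rests on \<open>S\<close> consisting of polynomials over
  \<open>I\<close> and on \<open>A\<close> being closed under its operations.\<close>

lemma env_rel_terms: "EE s t \<Longrightarrow> s \<in> TT \<and> t \<in> TT"
proof (induction rule: env_rel.induct)
  case (identity f \<sigma> us)
  then show ?case using foldr_terms S by (auto intro: rb_terms.intros)
next
  case (gen_vdash i a b)
  then show ?case using opr_closed[OF omega] by (auto simp: dend_ops_def intro!: rb_terms.intros)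
next
  case (gen_dashv i a b)
  then show ?case using opr_closed[OF omega] by (auto simp: dend_ops_def intro!: rb_terms.intros)
qed (auto intro!: rb_terms.intros)

lemma env_class_eq_iff: "s \<in> TT \<Longrightarrow> CC s = CC t \<longleftrightarrow> EE s t"
  unfolding env_class_def set_eq_iff mem_Collect_eq
  by (metis env_rel.refl env_rel.sym env_rel.trans)

lemma env_class_eqI: "EE s t \<Longrightarrow> CC s = CC t"
  using env_class_eq_iff env_rel_terms by blast

lemma envelope_carrier: "carrier UU = CC ` TT"
  by (simp add: envelope_def)

lemma env_class_carrier: "t \<in> TT \<Longrightarrow> CC t \<in> carrier UU"
  by (simp add: envelope_carrier)

text \<open>The operations of \<open>envelope\<close> are unions over all representatives. A class
  is nonempty, so such a union collapses to the common value once independence of the representative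
  is known.\<close>

lemma UN_env_class:
  assumes "t \<in> TT" "\<And>t'. EE t t' \<Longrightarrow> F t' = Z"
  shows "(\<Union>t'\<in>CC t. F t') = Z"
proof (rule SUP_eq_const)
  show "CC t \<noteq> {}"
    using env_rel.refl[OF assms(1)] unfolding env_class_def by (metis empty_iff mem_Collect_eq)
  show "F t' = Z" if "t' \<in> CC t" for t'
    using that assms(2) unfolding env_class_def by simp
qed

lemma envelope_zero: "\<zero>\<^bsub>UU\<^esub> = CC Zero"
  by (simp add: envelope_def)

section \<open>Operations on classes, computed on representatives\<close>

lemma envelope_add:
  assumes "s \<in> TT" "t \<in> TT"
  shows "CC s \<oplus>\<^bsub>UU\<^esub> CC t = CC (Plus s t)"
proof -
  have "CC (Plus s' t') = CC (Plus s t)" if "EE s s'" "EE t t'" for s' t'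
    by (intro env_class_eq_iff[THEN iffD2, symmetric] env_rel.cong_plus that rb_terms.intros assms)
  then show ?thesis
    by (simp add: envelope_def UN_env_class assms)
qed

lemma envelope_smult:
  assumes "c \<in> carrier K" "t \<in> TT"
  shows "c \<odot>\<^bsub>UU\<^esub> CC t = CC (Scale c t)"
proof -
  have "CC (Scale c t') = CC (Scale c t)" if "EE t t'" for t'
    by (intro env_class_eq_iff[THEN iffD2, symmetric] env_rel.cong_scale that rb_terms.intros assms)
  then show ?thesis
    by (simp add: envelope_def UN_env_class assms)
qed

lemma envelope_opr:
  assumes "i \<in> I" "s \<in> TT" "t \<in> TT"
  shows "opr UU i (CC s) (CC t) = CC (Prod i s t)"
proof -
  have "CC (Prod i s' t') = CC (Prod i s t)" if "EE s s'" "EE t t'" for s' t'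
    by (intro env_class_eq_iff[THEN iffD2, symmetric] env_rel.cong_prod that rb_terms.intros assms)
  then show ?thesis
    by (simp add: envelope_def UN_env_class assms)
qed

lemma envelope_rb:
  assumes "t \<in> TT"
  shows "rb UU (CC t) = CC (RB t)"
proof -
  have "CC (RB t') = CC (RB t)" if "EE t t'" for t'
    by (intro env_class_eq_iff[THEN iffD2, symmetric] env_rel.cong_rb that rb_terms.intros assms)
  then show ?thesis
    by (simp add: envelope_def UN_env_class assms)
qed

lemmas envelope_ops = envelope_carrier envelope_zero envelope_add envelope_smult envelope_opr
  envelope_rb rb_terms.intros

lemma env_rel_left_inverse:
  assumes "t \<in> TT"
  shows "EE (Plus (Scale (\<ominus>\<^bsub>K\<^esub> \<one>\<^bsub>K\<^esub>) t) t) Zero"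
proof -
  \<comment> \<open>The second summand \<open>t\<close> is rewritten as
    \<open>Scale \<one> t\<close>, so that distributivity in the scalar applies.\<close>
  have "EE (Plus (Scale (\<ominus>\<^bsub>K\<^esub> \<one>\<^bsub>K\<^esub>) t) t) (Plus (Scale (\<ominus>\<^bsub>K\<^esub> \<one>\<^bsub>K\<^esub>) t) (Scale \<one>\<^bsub>K\<^esub> t))"
    using assms by (intro env_rel.cong_plus env_rel.refl rb_terms.intros
        env_rel.sym[OF env_rel.one]) auto
  also have "EE \<dots> (Scale (\<ominus>\<^bsub>K\<^esub> \<one>\<^bsub>K\<^esub> \<oplus>\<^bsub>K\<^esub> \<one>\<^bsub>K\<^esub>) t)"
    using assms by (intro env_rel.sym[OF env_rel.l_distr]) auto
  also (env_rel.trans) have "EE \<dots> Zero"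
    using assms by (simp add: A.R.l_neg env_rel.scale_zero)
  finally (env_rel.trans) show ?thesis .
qed

text \<open>Every equational axiom is a generating rule read on classes; only additive inverses have
  to be constructed, by scaling with \<open>\<ominus> \<one>\<close>.\<close>

lemma omega_algebra_envelope: "omega_algebra K I UU"
  unfolding omega_algebra_def
proof (intro conjI ballI)
  show "module K UU"
  proof (rule moduleI)
    show "abelian_group UU"
    proof (rule abelian_groupI)
      fix X assume "X \<in> carrier UU"
      then obtain t where "t \<in> TT" "X = CC t" by (auto simp: envelope_carrier)
      then show "\<exists>Y\<in>carrier UU. Y \<oplus>\<^bsub>UU\<^esub> X = \<zero>\<^bsub>UU\<^esub>"
        by (intro bexI[of _ "CC (Scale (\<ominus>\<^bsub>K\<^esub> \<one>\<^bsub>K\<^esub>) t)"])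
          (simp_all add: envelope_ops env_class_eqI env_rel_left_inverse)
    qed (auto simp: envelope_ops intro!: env_class_eqI env_rel.assoc env_rel.comm env_rel.zero
        del: equalityI)
  qed (auto simp: envelope_ops A.R.is_cring intro!: env_class_eqI env_rel.l_distr env_rel.r_distr
      env_rel.scale_scale env_rel.one del: equalityI)
next
  fix i X assume "i \<in> I" "X \<in> carrier UU"
  then show "opr UU i X \<in> linear_maps K UU UU" "(\<lambda>Y. opr UU i Y X) \<in> linear_maps K UU UU"
    by (auto simp: envelope_ops intro!: linear_mapsI env_class_eqI env_rel.prod_plus_left
        env_rel.prod_plus_right env_rel.prod_scale_left env_rel.prod_scale_right del: equalityI)
qed

lemma eval_mono_envelope:
  assumes "range \<sigma> \<subseteq> TT" "op_symbols u \<subseteq> I"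
  shows "eval_mono UU (\<lambda>k. CC (\<sigma> k)) u = CC (subst_mono \<sigma> u)"
  using assms(2) by (induction u) (simp_all add: envelope_opr subst_mono_terms[OF assms(1)])

text \<open>A valuation in classes comes from a substitution of terms, and the value of
  \<open>f\<close> is then the class of the term that the rule \<open>identity\<close> relates to
  \<open>Zero\<close>.\<close>

lemma satisfies_envelope:
  assumes "f \<in> S"
  shows "satisfies K UU f"
  unfolding satisfies_def
proof (intro allI impI)
  interpret U: module K UU by (rule omega_algebra_module[OF omega_algebra_envelope])
  fix \<rho> :: "nat \<Rightarrow> ('k, 'i, 'a) rb_term set" assume "range \<rho> \<subseteq> carrier UU"
  then have "\<forall>k. \<exists>t\<in>TT. \<rho> k = CC t" by (auto simp: envelope_carrier)
  then obtain \<sigma> where \<sigma>: "range \<sigma> \<subseteq> TT" "\<And>k. \<rho> k = CC (\<sigma> k)"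
    by (metis image_subsetI)
  then have \<rho>: "\<rho> = (\<lambda>k. CC (\<sigma> k))" by auto
  have fS: "f \<in> npolys K I" using assms S by blast
  note f = npolysD[OF fS]
  \<comment> \<open>Stated for lists within the support, so that the induction can remove monomials;
    the full support is inserted afterwards.\<close>
  have sum: "(\<Oplus>\<^bsub>UU\<^esub>u\<in>set us. f u \<odot>\<^bsub>UU\<^esub> eval_mono UU \<rho> u) =
      CC (foldr (\<lambda>u t. Plus (Scale (f u) (subst_mono \<sigma> u)) t) us Zero)"
    if "distinct us" "set us \<subseteq> support K f" for us
    using that
  proof (induction us)
    case (Cons u us)
    have term_eq: "f v \<odot>\<^bsub>UU\<^esub> eval_mono UU \<rho> v = CC (Scale (f v) (subst_mono \<sigma> v))"
      "Scale (f v) (subst_mono \<sigma> v) \<in> TT"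
      if "v \<in> support K f" for v
      unfolding \<rho> using subst_mono_terms[OF \<sigma>(1) f(3)[OF that]] f(1)
      by (simp_all add: eval_mono_envelope[OF \<sigma>(1) f(3)[OF that]] envelope_ops)
    have "(\<Oplus>\<^bsub>UU\<^esub>u\<in>set (u # us). f u \<odot>\<^bsub>UU\<^esub> eval_mono UU \<rho> u) =
        f u \<odot>\<^bsub>UU\<^esub> eval_mono UU \<rho> u \<oplus>\<^bsub>UU\<^esub> (\<Oplus>\<^bsub>UU\<^esub>u\<in>set us. f u \<odot>\<^bsub>UU\<^esub> eval_mono UU \<rho> u)"
      using Cons.prems term_eq env_class_carrier
      by (simp only: list.set, intro U.M.finsum_insert) auto
    then show ?case
      using Cons term_eq foldr_terms[OF \<sigma>(1) fS] by (simp add: envelope_add)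
  qed (simp add: envelope_zero)
  obtain us where us: "set us = support K f" "distinct us"
    using finite_distinct_list[OF f(2)] by blast
  have "eval_poly K UU \<rho> f = CC (foldr (\<lambda>u t. Plus (Scale (f u) (subst_mono \<sigma> u)) t) us Zero)"
    unfolding eval_poly_def using sum[of us] us by simp
  also have "\<dots> = \<zero>\<^bsub>UU\<^esub>"
    unfolding envelope_zero using us assms \<sigma>(1) by (intro env_class_eqI env_rel.identity)
  finally show "eval_poly K UU \<rho> f = \<zero>\<^bsub>UU\<^esub>" .
qed

lemma rota_baxter_envelope: "rota_baxter_Var K I S UU"
  unfolding rota_baxter_Var_def in_Var_def
  by (auto simp: omega_algebra_envelope satisfies_envelope envelope_ops intro!: linear_mapsI
      env_class_eqI env_rel.rb_plus env_rel.rb_scale env_rel.rota_baxter del: equalityI)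

lemma canonical_map_hom: "canonical_map K I S A \<in> alg_hom K (dend_ops I) A (dend UU)"
  unfolding alg_hom_def canonical_map_def dend_def
  by (auto simp: dend_ops_def envelope_ops intro!: linear_mapsI env_class_eqI env_rel.gen_plus
      env_rel.gen_scale env_rel.gen_vdash env_rel.gen_dashv del: equalityI)

section \<open>Factorization of homomorphisms through the envelope\<close>

context
  fixes B :: "('k, 'b, 'i) rb_alg" and h :: "'a \<Rightarrow> 'b"
  assumes B: "rota_baxter_Var K I S B" and h: "h \<in> alg_hom K (dend_ops I) A (dend B)"
begin

lemma omega_B: "omega_algebra K I B"
  using B unfolding rota_baxter_Var_def in_Var_def by blast

interpretation B: module K B
  using omega_B by (rule omega_algebra_module)

lemma rb_linear: "rb B \<in> linear_maps K B B"
  using B unfolding rota_baxter_Var_def by blast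

lemma hom_gen:
  "a \<in> carrier A \<Longrightarrow> h a \<in> carrier B"
  "\<lbrakk>a \<in> carrier A; b \<in> carrier A\<rbrakk> \<Longrightarrow> h (a \<oplus>\<^bsub>A\<^esub> b) = h a \<oplus>\<^bsub>B\<^esub> h b"
  "\<lbrakk>c \<in> carrier K; a \<in> carrier A\<rbrakk> \<Longrightarrow> h (c \<odot>\<^bsub>A\<^esub> a) = c \<odot>\<^bsub>B\<^esub> h a"
  "\<lbrakk>i \<in> I; a \<in> carrier A; b \<in> carrier A\<rbrakk> \<Longrightarrow> h (opr A (Vdash i) a b) = opr B i (rb B (h a)) (h b)"
  "\<lbrakk>i \<in> I; a \<in> carrier A; b \<in> carrier A\<rbrakk> \<Longrightarrow> h (opr A (Dashv i) a b) = opr B i (h a) (rb B (h b))"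
  using h by (auto simp: alg_hom_def linear_maps_def dend_def dend_ops_def)

lemma interp_closed: "t \<in> TT \<Longrightarrow> interp B h t \<in> carrier B"
  by (induction rule: rb_terms.induct)
    (auto simp: hom_gen(1) linear_maps_closed[OF rb_linear] opr_closed[OF omega_B])

lemma interp_foldr:
  assumes "f \<in> npolys K I" "range \<sigma> \<subseteq> TT" "distinct us" "set us \<subseteq> support K f"
  shows "interp B h (foldr (\<lambda>u t. Plus (Scale (f u) (subst_mono \<sigma> u)) t) us Zero) =
    (\<Oplus>\<^bsub>B\<^esub>u\<in>set us. f u \<odot>\<^bsub>B\<^esub> eval_mono B (\<lambda>k. interp B h (\<sigma> k)) u)"
  using assms(3,4)
proof (induction us)
  case (Cons u us)
  have "f v \<odot>\<^bsub>B\<^esub> eval_mono B (\<lambda>k. interp B h (\<sigma> k)) v \<in> carrier B" if "v \<in> support K f" for v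
    using that assms(2) npolysD[OF assms(1)] interp_closed
    by (intro B.smult_closed eval_mono_closed[OF omega_B]) auto
  then have "(\<Oplus>\<^bsub>B\<^esub>u\<in>set (u # us). f u \<odot>\<^bsub>B\<^esub> eval_mono B (\<lambda>k. interp B h (\<sigma> k)) u) =
      f u \<odot>\<^bsub>B\<^esub> eval_mono B (\<lambda>k. interp B h (\<sigma> k)) u \<oplus>\<^bsub>B\<^esub>
      (\<Oplus>\<^bsub>B\<^esub>u\<in>set us. f u \<odot>\<^bsub>B\<^esub> eval_mono B (\<lambda>k. interp B h (\<sigma> k)) u)"
    using Cons.prems by (simp only: list.set, intro B.M.finsum_insert) auto
  with Cons show ?case by (simp add: interp_subst_mono)
qed simp

text \<open>Soundness: every rule holds in \<open>B\<close>, the identities because \<open>B\<close>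
  lies in the variety and the rules for generators because \<open>h\<close> is a homomorphism into
  \<open>dend B\<close>.\<close>

lemma interp_env_rel: "EE s t \<Longrightarrow> interp B h s = interp B h t"
proof (induction rule: env_rel.induct)
  case (identity f \<sigma> us)
  then have "satisfies K B f" "f \<in> npolys K I" using B S by (auto simp: rota_baxter_Var_def in_Var_def)
  moreover have "range (\<lambda>k. interp B h (\<sigma> k)) \<subseteq> carrier B"
    using identity interp_closed by blast
  ultimately show ?case
    using identity by (simp add: interp_foldr satisfies_def eval_poly_def)
next
  case (rota_baxter i s t)
  then show ?case
    using B interp_closed linear_mapsD[OF rb_linear] opr_closed[OF omega_B]
    by (simp add: rota_baxter_Var_def)
qed (simp_all add: interp_closed hom_gen linear_mapsD[OF rb_linear] opr_closed[OF omega_B]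
    linear_mapsD[OF opr_linear_left[OF omega_B]] linear_mapsD[OF opr_linear_right[OF omega_B]]
    B.smult_l_distr B.smult_r_distr B.smult_assoc1 B.M.a_ac)

text \<open>The value at an arbitrarily chosen representative; \<open>interp_env_rel\<close> makes
  the choice immaterial. The restriction puts the map into \<open>extensional\<close>, as uniqueness
  of the factorization requires.\<close>

definition lift_map :: "('k, 'i, 'a) rb_term set \<Rightarrow> 'b" where
  "lift_map = restrict (\<lambda>X. interp B h (SOME t. t \<in> X)) (carrier UU)"

lemma lift_map_class: "t \<in> TT \<Longrightarrow> lift_map (CC t) = interp B h t"
proof -
  assume t: "t \<in> TT"
  have "t \<in> CC t" using env_rel.refl[OF t] by (simp add: env_class_def)
  then have "(SOME s. s \<in> CC t) \<in> CC t" by (rule someI)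
  then have "EE t (SOME s. s \<in> CC t)" unfolding env_class_def by (rule CollectD)
  then have "interp B h (SOME s. s \<in> CC t) = interp B h t"
    by (rule interp_env_rel[symmetric])
  then show ?thesis using t by (simp add: lift_map_def env_class_carrier)
qed

lemma lift_map_hom: "lift_map \<in> rb_hom K I UU B"
  unfolding rb_hom_def alg_hom_def
  by (auto intro!: linear_mapsI simp: envelope_ops lift_map_class interp_closed)

text \<open>Gives uniqueness of the factorization: terms are built from generators by operations
  that \<open>g\<close> preserves, so the values of \<open>h\<close> determine
  \<open>g\<close>.\<close>

lemma rb_hom_class:
  assumes g: "g \<in> rb_hom K I UU B" and gen: "\<And>a. a \<in> carrier A \<Longrightarrow> g (canonical_map K I S A a) = h a"
    and t: "t \<in> TT"
  shows "g (CC t) = interp B h t"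
proof -
  have lin: "g \<in> linear_maps K UU B" using g by (simp add: rb_hom_def alg_hom_def)
  note g' = linear_mapsD[OF lin] linear_maps_zero[OF omega_algebra_module[OF omega_algebra_envelope] B.module_axioms lin]
  have opr: "\<lbrakk>i \<in> I; s \<in> TT; t \<in> TT\<rbrakk> \<Longrightarrow> g (CC (Prod i s t)) = opr B i (g (CC s)) (g (CC t))"
    and rb: "t \<in> TT \<Longrightarrow> g (CC (RB t)) = rb B (g (CC t))" for i s t
    using g env_class_carrier
    by (simp_all add: rb_hom_def alg_hom_def envelope_opr[symmetric] envelope_rb[symmetric])
  from t show ?thesis
  proof (induction rule: rb_terms.induct)
    case (1 a)
    then show ?case using gen by (simp add: canonical_map_def)
  next
    case 2
    then show ?case using g'(4) by (simp add: envelope_zero)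
  next
    case (3 s t)
    then show ?case
      using g'(2) env_class_carrier by (simp add: envelope_add[symmetric])
  next
    case (4 c t)
    then show ?case
      using g'(3) env_class_carrier by (simp add: envelope_smult[symmetric])
  qed (simp_all add: opr rb)
qed

lemma envelope_factorization:
  "\<exists>!g. g \<in> rb_hom K I UU B \<inter> extensional (carrier UU) \<and>
    (\<forall>x\<in>carrier A. g (canonical_map K I S A x) = h x)"
proof (rule ex1I[of _ lift_map])
  show "lift_map \<in> rb_hom K I UU B \<inter> extensional (carrier UU) \<and>
    (\<forall>x\<in>carrier A. lift_map (canonical_map K I S A x) = h x)"
    by (simp add: lift_map_hom canonical_map_def lift_map_class rb_terms.intros)
      (simp add: lift_map_def)
next
  fix g assume "g \<in> rb_hom K I UU B \<inter> extensional (carrier UU) \<and>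
    (\<forall>x\<in>carrier A. g (canonical_map K I S A x) = h x)"
  then have "g (CC t) = lift_map (CC t)" if "t \<in> TT" for t
    using that rb_hom_class lift_map_class by auto
  with \<open>g \<in> _ \<and> _\<close> show "g = lift_map"
    by (intro extensionalityI[of _ "carrier UU"]) (auto simp: envelope_carrier lift_map_def)
qed

end

text \<open>The type \<open>'b\<close> is arbitrary, so that one proof serves both the claimed
  universal property and its use on pairs, where the null extension lives.\<close>

lemma universal_envelope_envelope:
  "universal_envelope TYPE('b) K I S A UU (canonical_map K I S A)"
  unfolding universal_envelope_def
  by (intro conjI allI impI rota_baxter_envelope canonical_map_hom envelope_factorization)
    (elim conjE, assumption)+

end

section \<open>Injectivity, inherited from an injective map that factors through the canonical
  one\<close>

lemma universal_envelope_factor: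
  fixes B :: "('k, 'b, 'i) rb_alg"
  assumes "universal_envelope TYPE('b) K I S A U \<iota>" "rota_baxter_Var K I S B"
    and "h \<in> alg_hom K (dend_ops I) A (dend B)" "inj_on h (carrier A)"
  shows "inj_on \<iota> (carrier A)"
proof -
  have "\<exists>!g. g \<in> rb_hom K I U B \<inter> extensional (carrier U) \<and> (\<forall>x\<in>carrier A. g (\<iota> x) = h x)"
    using assms(1)[unfolded universal_envelope_def, THEN conjunct2, THEN conjunct2] assms(2,3)
    by simp
  then obtain g where g: "\<forall>x\<in>carrier A. g (\<iota> x) = h x" by (elim ex1E conjE)
  show ?thesis
  proof (rule inj_onI)
    fix x y assume "x \<in> carrier A" "y \<in> carrier A" "\<iota> x = \<iota> y"
    with g have "h x = h y" by metis
    with \<open>x \<in> _\<close> \<open>y \<in> _\<close> show "x = y" using assms(4) by (simp add: inj_on_def)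
  qed
qed

theorem corollary1:
  fixes K :: "('k, 'r) ring_scheme"
    and I :: "'i set"
    and S :: "('k, 'i) npoly set"
    and A :: "('k, 'a, 'i dend_op) alg"
  assumes "field K"
    and "\<forall>f\<in>S. \<exists>n\<ge>2. polylinear K I n f"
    and "di_Var_dendriform K I S A"
  shows "universal_envelope TYPE('b) K I S A (envelope K I S A) (canonical_map K I S A) \<and>
    inj_on (canonical_map K I S A) (carrier A) \<and>
    (\<forall>(V :: ('k, 'v, 'i) rb_alg) j.
       universal_envelope TYPE(('k, 'i, 'a) rb_term set) K I S A V j \<longrightarrow> inj_on j (carrier A))"
proof -
  have omega: "omega_algebra K (dend_ops I) A"
    using assms(3) by (simp add: di_Var_dendriform_def)
  have S: "S \<subseteq> npolys K I"
    using assms(2) polylinear_npolys by blast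
  have "satisfies K (null_ext A) f" if f: "f \<in> S" for f
  proof -
    obtain n where n: "polylinear K I n f" using assms(2) f by blast
    show ?thesis
      using assms(3) f n by (intro satisfies_null_ext[OF omega n]) (simp add: di_Var_dendriform_def)
  qed
  then have null: "rota_baxter_Var K I S (null_ext A)"
    by (rule rota_baxter_null_ext[OF omega])
  \<comment> \<open>The test algebra is the null extension, with the embedding
    \<open>a \<mapsto> (\<zero>, a)\<close> onto its ideal.\<close>
  have inj: "inj_on (canonical_map K I S A) (carrier A)"
    using universal_envelope_envelope[OF omega S] null null_ext_embedding[OF omega]
    by (rule universal_envelope_factor) (simp add: inj_on_def)
  \<comment> \<open>Another envelope \<open>V\<close> is tested against
    \<open>envelope K I S A\<close>, whose carrier lies in the type for which the universal property
    of \<open>V\<close> is assumed. The canonical map just shown to be injective then factors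
    through \<open>j\<close>.\<close>
  moreover have "inj_on j (carrier A)"
    if "universal_envelope TYPE(('k, 'i, 'a) rb_term set) K I S A V j"
    for V :: "('k, 'v, 'i) rb_alg" and j
    using that rota_baxter_envelope[OF omega S] canonical_map_hom[OF omega S] inj
    by (rule universal_envelope_factor)
  ultimately show ?thesis
    by (simp add: universal_envelope_envelope[OF omega S])
qed

end
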